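(* If there is a deterministic (respectively, randomized) polynomial time algorithm for BM', then there is a deterministic (respectively, randomized) polynomial time algorithm for the exact matching problem in bipartite graphs.
   Context: The $2$-covariate BM problem has the following input: - a finite set $\mathcal{T}$ of $n$ treatment samples and a finite set $\mathcal{C}$ of $n'$ control samples; - two covariates; covariate $p$ ($p=1,2$) has $k_p$ levels and partitions $\mathcal{T}$ into $L_{p,1},\dots,L_{p,k_p}$ with sizes $\ell_{p,i}$, and $\mathcal{C}$ into $L'_{p,1},\dots,L'_{p,k_p}$; - distances $\delta_{tc}$ for $t\in\mathcal{T}$, $c\in\mathcal{C}$. The task is to find an injective map $m:\mathcal{T}\to\mathcal{C}$ whose image $S'$ satisfies $|S'\cap L'_{p,i}|=\ell_{p,i}$ for all $p$ and $i$, minimizing $\sum_t\delta_{t,m(t)}$ (or to report that no such map exists). BM' denotes the special case in which: - the second covariate has a constant number $k_2$ of levels, while the first covariate is unrestricted; - the distances are nonnegative integers bounded by a polynomial $\pi$ of the input encoding length. The exact matching problem in bipartite graphs has as input a bipartite graph with sides $V_1,V_2$, $|V_1|=|V_2|=q$, whose edge set is partitioned into blue edges and red edges, together with an integer $k$. It asks whether there is a perfect matching with exactly $k$ blue edges. *)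

theory Defs
  imports "HOL-Probability.Probability" "HOL-Computational_Algebra.Polynomial"
begin

section \<open>The model of computation\<close>

text \<open>
  Polynomial time is formalized with structured WHILE programs over binary trees, as in
  N. D. Jones, \<^emph>\<open>Computability and Complexity from a Programming Perspective\<close>, but with a
  more conservative cost measure: the evaluation of an expression is charged, at each of its
  nodes, the full size of the tree computed there.  Hence the running time bounds
  the size of all data produced (no sharing of subtrees is exploited), copying and comparing
  trees cost at least their size, and running times agree up to a
  polynomial with those of multi-tape Turing machines, with or without coin tosses.
\<close>

datatype tree = Leaf | Node tree tree

fun tsize :: "tree \<Rightarrow> nat" where
  "tsize Leaf = 1"
| "tsize (Node a b) = tsize a + tsize b + 1"

definition enc_bool :: "bool \<Rightarrow> tree" where
  "enc_bool b = (if b then Node Leaf Leaf else Leaf)"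

datatype expr = VarE nat | NilE | ConsE expr expr | HdE expr | TlE expr | EqE expr expr

fun hd_tree :: "tree \<Rightarrow> tree" where
  "hd_tree Leaf = Leaf"
| "hd_tree (Node a b) = a"

fun tl_tree :: "tree \<Rightarrow> tree" where
  "tl_tree Leaf = Leaf"
| "tl_tree (Node a b) = b"

type_synonym store = "nat \<Rightarrow> tree"

fun value_of :: "expr \<Rightarrow> store \<Rightarrow> tree" where
  "value_of (VarE x) s = s x"
| "value_of NilE s = Leaf"
| "value_of (ConsE a b) s = Node (value_of a s) (value_of b s)"
| "value_of (HdE a) s = hd_tree (value_of a s)"
| "value_of (TlE a) s = tl_tree (value_of a s)"
| "value_of (EqE a b) s = enc_bool (value_of a s = value_of b s)"

fun expr_cost :: "expr \<Rightarrow> store \<Rightarrow> nat" where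
  "expr_cost (VarE x) s = tsize (value_of (VarE x) s)"
| "expr_cost NilE s = tsize (value_of NilE s)"
| "expr_cost (ConsE a b) s = tsize (value_of (ConsE a b) s) + expr_cost a s + expr_cost b s"
| "expr_cost (HdE a) s = tsize (value_of (HdE a) s) + expr_cost a s"
| "expr_cost (TlE a) s = tsize (value_of (TlE a) s) + expr_cost a s"
| "expr_cost (EqE a b) s = tsize (value_of (EqE a b) s) + expr_cost a s + expr_cost b s"

datatype com =
    Skip
  | Assign nat expr
  | Flip nat
  | Seq com com
  | Cond expr com com
  | While expr com

fun coin_free :: "com \<Rightarrow> bool" where
  "coin_free Skip = True"
| "coin_free (Assign x e) = True"
| "coin_free (Flip x) = False"
| "coin_free (Seq c d) = (coin_free c \<and> coin_free d)"
| "coin_free (Cond e c d) = (coin_free c \<and> coin_free d)"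
| "coin_free (While e c) = coin_free c"

text \<open>
  \<open>exec c (s, r) t (s', r')\<close>: started in store \<open>s\<close> with the outcomes \<open>r\<close> of future coin
  tosses, \<open>c\<close> halts after time \<open>t\<close> in store \<open>s'\<close>, with the tosses \<open>r'\<close> still unused.  A toss
  with no outcome left is stuck.  Every tree other than \<open>Leaf\<close> counts as true.
\<close>

inductive exec :: "com \<Rightarrow> store \<times> bool list \<Rightarrow> nat \<Rightarrow> store \<times> bool list \<Rightarrow> bool" where
  Skip: "exec Skip (s, r) 1 (s, r)"
| Assign: "exec (Assign x e) (s, r) (1 + expr_cost e s) (s(x := value_of e s), r)"
| Flip: "exec (Flip x) (s, b # r) 1 (s(x := enc_bool b), r)"
| Seq: "exec c (s, r) t (s', r') \<Longrightarrow> exec d (s', r') t' (s'', r'')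
    \<Longrightarrow> exec (Seq c d) (s, r) (t + t') (s'', r'')"
| CondTrue: "value_of e s \<noteq> Leaf \<Longrightarrow> exec c (s, r) t (s', r')
    \<Longrightarrow> exec (Cond e c d) (s, r) (1 + expr_cost e s + t) (s', r')"
| CondFalse: "value_of e s = Leaf \<Longrightarrow> exec d (s, r) t (s', r')
    \<Longrightarrow> exec (Cond e c d) (s, r) (1 + expr_cost e s + t) (s', r')"
| WhileFalse: "value_of e s = Leaf
    \<Longrightarrow> exec (While e c) (s, r) (1 + expr_cost e s) (s, r)"
| WhileTrue: "value_of e s \<noteq> Leaf \<Longrightarrow> exec c (s, r) t (s', r')
    \<Longrightarrow> exec (While e c) (s', r') t' (s'', r'')
    \<Longrightarrow> exec (While e c) (s, r) (1 + expr_cost e s + t + t') (s'', r'')"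

text \<open>Input and output are held in variable 0; all other variables are initially \<open>Leaf\<close>.\<close>

definition run :: "com \<Rightarrow> tree \<Rightarrow> bool list \<Rightarrow> nat \<Rightarrow> tree \<Rightarrow> bool" where
  "run c x r t y \<longleftrightarrow> (\<exists>s r'. exec c ((\<lambda>_. Leaf)(0 := x), r) t (s, r') \<and> s 0 = y)"

text \<open>
  A computational problem is given by its set \<open>D\<close> of instances, an encoding of instances as
  trees, and the set of correct outputs for each instance.  A decision problem has the single
  correct output \<open>enc_bool b\<close>; for a search problem any correct output is acceptable.
  Inputs that do not encode an instance are irrelevant.
\<close>

definition det_poly_time :: "'i set \<Rightarrow> ('i \<Rightarrow> tree) \<Rightarrow> ('i \<Rightarrow> tree set) \<Rightarrow> bool" where
  "det_poly_time D enc correct \<longleftrightarrow>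
     (\<exists>(c :: com) (p :: nat poly). coin_free c \<and>
        (\<forall>I\<in>D. \<exists>t y. run c (enc I) [] t y \<and> t \<le> poly p (tsize (enc I)) \<and> y \<in> correct I))"

text \<open>
  Randomized algorithms have worst-case polynomial running time and, on every instance, a
  correct output with probability at least 2/3.  As a toss costs one time
  unit, a run of time at most \<open>T\<close> never uses more than \<open>T\<close> tosses.
\<close>

definition rand_poly_time :: "'i set \<Rightarrow> ('i \<Rightarrow> tree) \<Rightarrow> ('i \<Rightarrow> tree set) \<Rightarrow> bool" where
  "rand_poly_time D enc correct \<longleftrightarrow>
     (\<exists>(c :: com) (p :: nat poly). \<forall>I\<in>D.
        let T = poly p (tsize (enc I)); R = {r :: bool list. length r = T} in
          (\<forall>r\<in>R. \<exists>t y. run c (enc I) r t y \<and> t \<le> T) \<and>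
          measure_pmf.prob (pmf_of_set R) {r. \<exists>t. \<exists>y\<in>correct I. run c (enc I) r t y} \<ge> 2 / 3)"


section \<open>Encodings\<close>

text \<open>Numbers are written in binary, least significant bit first.\<close>

fun enc_nat :: "nat \<Rightarrow> tree" where
  "enc_nat n = (if n = 0 then Leaf else Node (enc_bool (odd n)) (enc_nat (n div 2)))"

declare enc_nat.simps [simp del]

definition enc_int :: "int \<Rightarrow> tree" where
  "enc_int i = Node (enc_bool (i < 0)) (enc_nat (nat \<bar>i\<bar>))"

fun enc_list :: "('a \<Rightarrow> tree) \<Rightarrow> 'a list \<Rightarrow> tree" where
  "enc_list f [] = Leaf"
| "enc_list f (x # xs) = Node (f x) (enc_list f xs)"

definition enc_prod :: "('a \<Rightarrow> tree) \<Rightarrow> ('b \<Rightarrow> tree) \<Rightarrow> 'a \<times> 'b \<Rightarrow> tree" where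
  "enc_prod f g z = Node (f (fst z)) (g (snd z))"

definition enc_option :: "('a \<Rightarrow> tree) \<Rightarrow> 'a option \<Rightarrow> tree" where
  "enc_option f z = (case z of None \<Rightarrow> Leaf | Some x \<Rightarrow> Node Leaf (f x))"

text \<open>
  Finite sets \<open>{0..<n}\<close> of vertices or levels are given by listing their elements, so an
  encoding is at least as long as the number of vertices or levels.
\<close>

definition enc_range :: "nat \<Rightarrow> tree" where
  "enc_range n = enc_list enc_nat [0..<n]"


section \<open>The 2-covariate balanced matching problem\<close>

text \<open>
  Treatment samples, control samples and the levels of each covariate are numbered from 0.
  The entry of a sample in \<open>treatments\<close> or \<open>controls\<close> is the pair of its levels under
  covariates 1 and 2.  Levels without samples are allowed.  The distances are
  natural numbers, as they are in BM'.
\<close>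

record bm_instance =
  levels1 :: nat
  levels2 :: nat
  treatments :: "(nat \<times> nat) list"
  controls :: "(nat \<times> nat) list"
  distances :: "nat list list"

definition T_set :: "bm_instance \<Rightarrow> nat set" where
  "T_set I = {0..<length (treatments I)}"

definition C_set :: "bm_instance \<Rightarrow> nat set" where
  "C_set I = {0..<length (controls I)}"

definition num_levels :: "bm_instance \<Rightarrow> nat \<Rightarrow> nat" where
  "num_levels I p = (if p = 1 then levels1 I else levels2 I)"

definition level :: "nat \<Rightarrow> nat \<times> nat \<Rightarrow> nat" where
  "level p z = (if p = 1 then fst z else snd z)"

definition L_treat :: "bm_instance \<Rightarrow> nat \<Rightarrow> nat \<Rightarrow> nat set" where
  "L_treat I p i = {t \<in> T_set I. level p (treatments I ! t) = i}"

definition L_control :: "bm_instance \<Rightarrow> nat \<Rightarrow> nat \<Rightarrow> nat set" where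
  "L_control I p i = {c \<in> C_set I. level p (controls I ! c) = i}"

definition delta :: "bm_instance \<Rightarrow> nat \<Rightarrow> nat \<Rightarrow> nat" where
  "delta I t c = distances I ! t ! c"

definition bm_valid :: "bm_instance \<Rightarrow> bool" where
  "bm_valid I \<longleftrightarrow>
     (\<forall>p\<in>{1,2}. \<forall>z \<in> set (treatments I) \<union> set (controls I). level p z < num_levels I p) \<and>
     length (distances I) = length (treatments I) \<and>
     (\<forall>row \<in> set (distances I). length row = length (controls I))"

definition bm_feasible :: "bm_instance \<Rightarrow> (nat \<Rightarrow> nat) \<Rightarrow> bool" where
  "bm_feasible I m \<longleftrightarrow>
     m \<in> T_set I \<rightarrow> C_set I \<and> inj_on m (T_set I) \<and>
     (\<forall>p\<in>{1,2}. \<forall>i<num_levels I p.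
        card (m ` T_set I \<inter> L_control I p i) = card (L_treat I p i))"

definition bm_cost :: "bm_instance \<Rightarrow> (nat \<Rightarrow> nat) \<Rightarrow> nat" where
  "bm_cost I m = (\<Sum>t\<in>T_set I. delta I t (m t))"

definition bm_optimal :: "bm_instance \<Rightarrow> (nat \<Rightarrow> nat) \<Rightarrow> bool" where
  "bm_optimal I m \<longleftrightarrow>
     bm_feasible I m \<and> (\<forall>m'. bm_feasible I m' \<longrightarrow> bm_cost I m \<le> bm_cost I m')"

definition enc_bm :: "bm_instance \<Rightarrow> tree" where
  "enc_bm I =
     Node (enc_range (levels1 I)) (Node (enc_range (levels2 I))
       (Node (enc_list (enc_prod enc_nat enc_nat) (treatments I))
         (Node (enc_list (enc_prod enc_nat enc_nat) (controls I))
           (enc_list (enc_list enc_nat) (distances I)))))"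

text \<open>The output encodes \<open>None\<close>, or \<open>Some\<close> list of the values of an optimal map on \<open>0, 1, \<dots>\<close>.\<close>

definition bm_solution :: "bm_instance \<Rightarrow> nat list option \<Rightarrow> bool" where
  "bm_solution I z \<longleftrightarrow>
     (case z of
        None \<Rightarrow> \<not> (\<exists>m. bm_feasible I m)
      | Some ms \<Rightarrow> length ms = length (treatments I) \<and> bm_optimal I (\<lambda>t. ms ! t))"

definition bm_correct :: "bm_instance \<Rightarrow> tree set" where
  "bm_correct I = enc_option (enc_list enc_nat) ` {z. bm_solution I z}"

text \<open>
  BM' for a given constant number \<open>k2\<close> of levels of the second covariate and a given
  polynomial bound \<open>\<pi>\<close> on the distances.
\<close>

definition bm'_instances :: "nat \<Rightarrow> nat poly \<Rightarrow> bm_instance set" where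
  "bm'_instances k2 \<pi> =
     {I. bm_valid I \<and> num_levels I 2 = k2 \<and>
         (\<forall>t\<in>T_set I. \<forall>c\<in>C_set I. delta I t c \<le> poly \<pi> (tsize (enc_bm I)))}"


section \<open>Exact matching in bipartite graphs\<close>

text \<open>
  Both sides \<open>V\<^sub>1\<close>, \<open>V\<^sub>2\<close> are numbered by \<open>{0..<q}\<close>; an edge \<open>(u, v)\<close> joins \<open>u \<in> V\<^sub>1\<close> with
  \<open>v \<in> V\<^sub>2\<close>.
\<close>

record em_instance =
  side_size :: nat
  blue_edges :: "(nat \<times> nat) list"
  red_edges :: "(nat \<times> nat) list"
  target :: int

definition em_instances :: "em_instance set" where
  "em_instances =
     {I. distinct (blue_edges I) \<and> distinct (red_edges I) \<and>
         set (blue_edges I) \<inter> set (red_edges I) = {} \<and>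
         set (blue_edges I) \<union> set (red_edges I) \<subseteq> {0..<side_size I} \<times> {0..<side_size I}}"

definition perfect_matching :: "nat \<Rightarrow> (nat \<times> nat) set \<Rightarrow> (nat \<times> nat) set \<Rightarrow> bool" where
  "perfect_matching q E M \<longleftrightarrow>
     M \<subseteq> E \<and> (\<forall>u\<in>{0..<q}. \<exists>!e. e \<in> M \<and> fst e = u) \<and> (\<forall>v\<in>{0..<q}. \<exists>!e. e \<in> M \<and> snd e = v)"

definition has_exact_matching :: "em_instance \<Rightarrow> bool" where
  "has_exact_matching I \<longleftrightarrow>
     (\<exists>M. perfect_matching (side_size I) (set (blue_edges I) \<union> set (red_edges I)) M \<and>
          int (card (M \<inter> set (blue_edges I))) = target I)"

definition enc_em :: "em_instance \<Rightarrow> tree" where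
  "enc_em I =
     Node (enc_range (side_size I))
       (Node (enc_list (enc_prod enc_nat enc_nat) (blue_edges I))
         (Node (enc_list (enc_prod enc_nat enc_nat) (red_edges I))
           (enc_int (target I))))"

definition em_correct :: "em_instance \<Rightarrow> tree set" where
  "em_correct I = {enc_bool (has_exact_matching I)}"


section \<open>The semantics is deterministic and the encodings are injective\<close>

inductive_cases exec_cases: "exec Skip z t y" "exec (Assign x e) z t y" "exec (Flip x) z t y"
inductive_cases exec_seq: "exec (Seq c d) z t y"
inductive_cases exec_cond: "exec (Cond e c d) z t y"
inductive_cases exec_while: "exec (While e c) z t y"

lemma exec_deterministic:
  "exec c z t y \<Longrightarrow> exec c z t' y' \<Longrightarrow> t' = t \<and> y' = y"
proof (induction arbitrary: t' y' rule: exec.induct)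
  case (Seq c s r t s' r' d t'' s'' r'')
  from Seq.prems show ?case by (rule exec_seq) (use Seq.IH in blast)
next
  case (CondTrue e s c r t s' r' d)
  from CondTrue.prems show ?case by (rule exec_cond) (use CondTrue.hyps CondTrue.IH in fastforce)+
next
  case (CondFalse e s d r t s' r' c)
  from CondFalse.prems show ?case by (rule exec_cond) (use CondFalse.hyps CondFalse.IH in fastforce)+
next
  case (WhileFalse e s c r)
  from WhileFalse.prems show ?case by (rule exec_while) (use WhileFalse.hyps in fastforce)+
next
  case (WhileTrue e s c r t s' r' t'' s'' r'')
  from WhileTrue.prems obtain u1 u2 s1 r1 s2 r2
    where "t' = 1 + expr_cost e s + u1 + u2" "y' = (s2, r2)"
      and *: "exec c (s, r) u1 (s1, r1)" "exec (While e c) (s1, r1) u2 (s2, r2)"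
    by (rule exec_while) (use WhileTrue.hyps in auto)
  moreover from WhileTrue.IH(1)[OF *(1)] have "u1 = t" "s1 = s'" "r1 = r'" by auto
  moreover from this WhileTrue.IH(2) *(2) have "u2 = t'' \<and> (s2, r2) = (s'', r'')" by blast
  ultimately show ?case by simp
qed (erule exec_cases; simp)+

lemma enc_bool_inj: "enc_bool a = enc_bool b \<longleftrightarrow> a = b"
  by (simp add: enc_bool_def)

lemma enc_nat_inj: "enc_nat m = enc_nat n \<Longrightarrow> m = n"
proof (induction m arbitrary: n rule: less_induct)
  case (less m)
  note u = enc_nat.simps[of m] enc_nat.simps[of n]
  show ?case
  proof (cases "m = 0 \<or> n = 0")
    case True
    then show ?thesis using less.prems u by (auto split: if_splits)
  next
    case False
    then have o: "odd m = odd n" and d: "enc_nat (m div 2) = enc_nat (n div 2)"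
      using less.prems u by (simp_all add: enc_bool_inj)
    from False d have "m div 2 = n div 2" by (intro less.IH) auto
    with o show ?thesis by presburger
  qed
qed

lemma enc_list_inj:
  "(\<And>x y. f x = f y \<Longrightarrow> x = y) \<Longrightarrow> enc_list f xs = enc_list f ys \<Longrightarrow> xs = ys"
proof (induction xs arbitrary: ys)
  case Nil then show ?case by (cases ys) auto
next
  case (Cons x xs) then show ?case by (cases ys) auto
qed

lemma enc_rows_inj:
  "enc_list (enc_list enc_nat) xs = enc_list (enc_list enc_nat) ys \<Longrightarrow> xs = ys"
  by (rule enc_list_inj[of "enc_list enc_nat"]) (auto intro: enc_list_inj enc_nat_inj)

lemma enc_prod_inj: "enc_prod enc_nat enc_nat x = enc_prod enc_nat enc_nat y \<Longrightarrow> x = y"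
  by (auto simp: enc_prod_def prod_eq_iff dest: enc_nat_inj)

lemma enc_range_inj: "enc_range m = enc_range n \<Longrightarrow> m = n"
  unfolding enc_range_def
  using enc_list_inj[of enc_nat "[0..<m]" "[0..<n]", OF enc_nat_inj] by (metis diff_zero length_upt)

lemma inj_enc_bm: "inj enc_bm"
proof (rule injI)
  fix I J :: bm_instance
  assume "enc_bm I = enc_bm J"
  then have "levels1 I = levels1 J" "levels2 I = levels2 J" "treatments I = treatments J"
      "controls I = controls J" "distances I = distances J"
    unfolding enc_bm_def tree.inject
    by (blast intro: enc_range_inj enc_list_inj[OF enc_prod_inj]
        enc_rows_inj)+
  then show "I = J" by simp
qed

lemma inj_enc_em: "inj enc_em"
proof (rule injI)
  fix I J :: em_instance
  assume *: "enc_em I = enc_em J"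
  have "enc_int i = enc_int j \<Longrightarrow> i = j" for i j
    using enc_nat_inj[of "nat \<bar>i\<bar>" "nat \<bar>j\<bar>"] by (auto simp: enc_int_def enc_bool_inj)
  with * have "side_size I = side_size J" "blue_edges I = blue_edges J"
      "red_edges I = red_edges J" "target I = target J"
    unfolding enc_em_def tree.inject
    by (blast intro: enc_range_inj enc_list_inj[OF enc_prod_inj])+
  then show "I = J" by simp
qed
end

theory Submission
  imports Defs
begin

text \<open>
  Given an exact matching instance with \<open>0 \<le> k \<le> q\<close>, let the treatments be the vertices of \<open>V\<^sub>1\<close>
  and let each \<open>v \<in> V\<^sub>2\<close> give two controls, a blue and a red one.  The distance from \<open>u\<close> to a
  control of \<open>v\<close> is 0 if \<open>(u, v)\<close> is an edge of that colour and 1 otherwise.  The first covariate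
  has one level per vertex and one treatment in each level, so that exactly one control of every \<open>v\<close>
  is chosen; the second covariate is the colour, with exactly \<open>k\<close> treatments labelled blue.  Then the maps
  of cost 0 are the perfect matchings with \<open>k\<close> blue edges.  In the randomized case the composed algorithm is
  given more coins than the algorithm for BM', but a prefix of a uniform bit string is uniform.
\<close>

section \<open>Polynomial-time tree functions\<close>

text \<open>The two copies of a vertex turn the colour of an edge, which belongs to a pair, into an
  attribute of a single control; this is what lets a covariate count blue edges. The answer is
  judged by checking that every treatment is sent along an edge of the right colour, not by adding
  up distances: these are 0 or 1, so an optimal map passes the test exactly if some feasible map
  does. Targets outside the range from 0 to q are not filtered beforehand: they too yield a BM'
  instance, and the range is tested when the answer is read. Most of the length comes from the
  model. Trees have no arithmetic, so the reduction is assembled from closure properties of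
  polynomial-time functions, and the algorithm for BM' is an unknown program that has to run
  correctly among the leftover data of the surrounding one.\<close>

lemma poly_nat_mono: "x \<le> y \<Longrightarrow> poly (p :: nat poly) x \<le> poly p y"
  by (induction p) (auto intro!: add_mono mult_mono)

lemma tsize_pos: "0 < tsize x"
  by (cases x) auto

lemma tsize_hd_tree: "tsize (hd_tree x) \<le> tsize x"
  by (cases x) auto

lemma tsize_tl_tree: "tsize (tl_tree x) \<le> tsize x"
  by (cases x) auto

lemma tsize_enc_bool: "tsize (enc_bool b) \<le> 3"
  by (simp add: enc_bool_def)

lemma enc_bool_eq_Leaf: "enc_bool b = Leaf \<longleftrightarrow> \<not> b"
  by (simp add: enc_bool_def)

lemma tsize_value_of: "tsize (value_of e s) \<le> expr_cost e s"
  by (cases e) auto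

text \<open>
  \<open>c\<close> reads variable \<open>i\<close>, writes \<open>j\<close>, and uses the variables from \<open>n\<close> on as scratch space,
  making no assumption on their initial contents.
\<close>

definition computes :: "nat \<Rightarrow> nat \<Rightarrow> nat \<Rightarrow> com \<Rightarrow> nat poly \<Rightarrow> (tree \<Rightarrow> tree) \<Rightarrow> bool" where
  "computes n i j c p f \<longleftrightarrow> coin_free c \<and>
     (\<forall>s r. \<exists>t s'. exec c (s, r) t (s', r) \<and>
        t + tsize (f (s i)) \<le> poly p (tsize (s i)) \<and>
        s' j = f (s i) \<and> (\<forall>x<n. x \<noteq> j \<longrightarrow> s' x = s x))"

text \<open>Asking for a program for every choice of input, output and scratch variables (even
  \<open>i = j\<close>) leaves constructions free to place intermediate results where later programs
  do not overwrite them.\<close>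

definition poly_time_fun :: "(tree \<Rightarrow> tree) \<Rightarrow> bool" where
  "poly_time_fun f \<longleftrightarrow> (\<forall>n i j. i < n \<longrightarrow> j < n \<longrightarrow> (\<exists>c p. computes n i j c p f))"

lemma poly_time_funD:
  assumes "poly_time_fun f" "i < n" "j < n"
  obtains c p where "computes n i j c p f"
  using assms unfolding poly_time_fun_def by blast

lemma computes_coin_free: "computes n i j c p f \<Longrightarrow> coin_free c"
  by (simp add: computes_def)

lemma computesE:
  assumes "computes n i j c p f"
  obtains t s' where "exec c (s, r) t (s', r)" "t + tsize (f (s i)) \<le> poly p (tsize (s i))"
    "s' j = f (s i)" "\<And>x. x < n \<Longrightarrow> x \<noteq> j \<Longrightarrow> s' x = s x"
  using assms unfolding computes_def by blast

lemma poly_time_fun_size: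
  assumes "poly_time_fun f"
  obtains p where "\<And>x. tsize (f x) \<le> poly p (tsize x)"
proof -
  obtain c p where c: "computes 1 0 0 c p f"
    by (rule poly_time_funD[OF assms, where i = 0 and j = 0 and n = 1]) auto
  have "tsize (f x) \<le> poly p (tsize x)" for x
    using computesE[OF c, where s = "\<lambda>_. x" and r = "[]"] by fastforce
  then show ?thesis by (rule that)
qed

lemma poly_time_fun_expr:
  assumes "\<And>i s. value_of (e i) s = f (s i)" "\<And>i s. expr_cost (e i) s \<le> k * tsize (s i)"
  shows "poly_time_fun f"
  unfolding poly_time_fun_def
proof (intro allI impI exI)
  fix n i j :: nat
  \<comment> \<open>One \<open>k * tsize\<close> pays for evaluating the expression, the other for
    the size of its value; 1 is the assignment itself.\<close>
  show "computes n i j (Assign j (e i)) [:1, 2 * k:] f"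
    unfolding computes_def
  proof (intro conjI allI)
    fix s :: store and r :: "bool list"
    have "tsize (f (s i)) \<le> k * tsize (s i)"
      using tsize_value_of[of "e i" s] assms(2)[of i s] by (simp add: assms(1))
    then show "\<exists>t s'. exec (Assign j (e i)) (s, r) t (s', r) \<and>
        t + tsize (f (s i)) \<le> poly [:1, 2 * k:] (tsize (s i)) \<and>
        s' j = f (s i) \<and> (\<forall>x<n. x \<noteq> j \<longrightarrow> s' x = s x)"
      using assms(2)[of i s]
      by (intro exI[of _ "1 + expr_cost (e i) s"] exI[of _ "s(j := value_of (e i) s)"])
        (use exec.Assign[of j "e i" s r] in \<open>auto simp: assms(1) algebra_simps\<close>)
  qed simp
qed

lemma poly_time_fun_id: "poly_time_fun (\<lambda>x. x)"
  by (rule poly_time_fun_expr[where e = VarE and k = 1]) auto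

lemma poly_time_fun_Leaf: "poly_time_fun (\<lambda>x. Leaf)"
  by (rule poly_time_fun_expr[where e = "\<lambda>_. NilE" and k = 1])
    (auto simp: Suc_le_eq tsize_pos)

text \<open>The intermediate value goes into the fresh variable \<open>n\<close>, and scratch space
  starts at \<open>Suc n\<close>. Since \<open>computes\<close> bounds output size along with time,
  the second program runs on an input of size at most \<open>poly p\<close>, which explains
  \<open>pcompose q p\<close>.\<close>

lemma poly_time_fun_comp:
  assumes g: "poly_time_fun g" and f: "poly_time_fun f"
  shows "poly_time_fun (\<lambda>x. g (f x))"
  unfolding poly_time_fun_def
proof (intro allI impI)
  fix n i j :: nat
  assume ij: "i < n" "j < n"
  obtain c p where c: "computes (Suc n) i n c p f"
    by (rule poly_time_funD[OF f, of i "Suc n" n]) (use ij in auto)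
  obtain d q where d: "computes (Suc n) n j d q g"
    by (rule poly_time_funD[OF g, of n "Suc n" j]) (use ij in auto)
  have "computes n i j (Seq c d) (p + pcompose q p) (\<lambda>x. g (f x))"
    unfolding computes_def
  proof (intro conjI allI)
    fix s r
    obtain t s1 where 1: "exec c (s, r) t (s1, r)" "t + tsize (f (s i)) \<le> poly p (tsize (s i))"
      "s1 n = f (s i)" "\<And>x. x < Suc n \<Longrightarrow> x \<noteq> n \<Longrightarrow> s1 x = s x"
      by (rule computesE[OF c, where s = s and r = r]) (rule that)
    obtain t' s2 where 2: "exec d (s1, r) t' (s2, r)"
      "t' + tsize (g (s1 n)) \<le> poly q (tsize (s1 n))"
      "s2 j = g (s1 n)" "\<And>x. x < Suc n \<Longrightarrow> x \<noteq> j \<Longrightarrow> s2 x = s1 x"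
      by (rule computesE[OF d, where s = s1 and r = r]) (rule that)
    have "poly q (tsize (s1 n)) \<le> poly q (poly p (tsize (s i)))"
      using 1 by (intro poly_nat_mono) simp
    then show "\<exists>t s'. exec (Seq c d) (s, r) t (s', r) \<and>
        t + tsize (g (f (s i))) \<le> poly (p + pcompose q p) (tsize (s i)) \<and>
        s' j = g (f (s i)) \<and> (\<forall>x<n. x \<noteq> j \<longrightarrow> s' x = s x)"
      using 1 2 by (intro exI[of _ "t + t'"] exI[of _ s2])
        (auto intro: exec.Seq simp: poly_pcompose)
  qed (use computes_coin_free[OF c] computes_coin_free[OF d] in simp)
  then show "\<exists>c p. computes n i j c p (\<lambda>x. g (f x))" by blast
qed

lemma poly_time_fun_hd: "poly_time_fun f \<Longrightarrow> poly_time_fun (\<lambda>x. hd_tree (f x))"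
proof (erule poly_time_fun_comp[rotated])
  show "poly_time_fun hd_tree"
    by (rule poly_time_fun_expr[where e = "\<lambda>i. HdE (VarE i)" and k = 2])
      (use tsize_hd_tree in \<open>auto simp: mult_2\<close>)
qed

lemma poly_time_fun_tl: "poly_time_fun f \<Longrightarrow> poly_time_fun (\<lambda>x. tl_tree (f x))"
proof (erule poly_time_fun_comp[rotated])
  show "poly_time_fun tl_tree"
    by (rule poly_time_fun_expr[where e = "\<lambda>i. TlE (VarE i)" and k = 2])
      (use tsize_tl_tree in \<open>auto simp: mult_2\<close>)
qed

lemma poly_time_fun_Node:
  assumes f: "poly_time_fun f" and g: "poly_time_fun g"
  shows "poly_time_fun (\<lambda>x. Node (f x) (g x))"
  unfolding poly_time_fun_def
proof (intro allI impI)
  fix n i j :: nat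
  assume ij: "i < n" "j < n"
  obtain c p where c: "computes (n + 2) i n c p f"
    by (rule poly_time_funD[OF f, of i "n + 2" n]) (use ij in auto)
  obtain d q where d: "computes (n + 2) i (Suc n) d q g"
    by (rule poly_time_funD[OF g, of i "n + 2" "Suc n"]) (use ij in auto)
  let ?c = "Seq c (Seq d (Assign j (ConsE (VarE n) (VarE (Suc n)))))"
  \<comment> \<open>The sizes of the two components are charged three times: as evaluated
    subexpressions, inside the new node, and as the output.\<close>
  let ?p = "[:3:] + [:3:] * (p + q)"
  have "computes n i j ?c ?p (\<lambda>x. Node (f x) (g x))"
    unfolding computes_def
  proof (intro conjI allI)
    fix s r
    obtain t s1 where 1: "exec c (s, r) t (s1, r)" "t + tsize (f (s i)) \<le> poly p (tsize (s i))"
      "s1 n = f (s i)" "\<And>x. x < n + 2 \<Longrightarrow> x \<noteq> n \<Longrightarrow> s1 x = s x"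
      by (rule computesE[OF c, where s = s and r = r]) (rule that)
    obtain t' s2 where 2: "exec d (s1, r) t' (s2, r)"
      "t' + tsize (g (s1 i)) \<le> poly q (tsize (s1 i))"
      "s2 (Suc n) = g (s1 i)" "\<And>x. x < n + 2 \<Longrightarrow> x \<noteq> Suc n \<Longrightarrow> s2 x = s1 x"
      by (rule computesE[OF d, where s = s1 and r = r]) (rule that)
    have [simp]: "s1 i = s i" "s2 n = f (s i)" using 1 2 ij by auto
    let ?e = "ConsE (VarE n) (VarE (Suc n))"
    show "\<exists>t s'. exec ?c (s, r) t (s', r) \<and>
        t + tsize (Node (f (s i)) (g (s i))) \<le> poly ?p (tsize (s i)) \<and>
        s' j = Node (f (s i)) (g (s i)) \<and> (\<forall>x<n. x \<noteq> j \<longrightarrow> s' x = s x)"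
    proof (intro exI conjI)
      show "exec ?c (s, r) (t + (t' + (1 + expr_cost ?e s2))) (s2(j := value_of ?e s2), r)"
        by (intro exec.Seq[OF 1(1)] exec.Seq[OF 2(1)] exec.Assign)
      show "(t + (t' + (1 + expr_cost ?e s2))) + tsize (Node (f (s i)) (g (s i)))
          \<le> poly ?p (tsize (s i))"
        using 1(2) 2(2,3) by simp
    qed (use 1 2 in auto)
  qed (use computes_coin_free[OF c] computes_coin_free[OF d] in simp)
  then show "\<exists>c p. computes n i j c p (\<lambda>x. Node (f x) (g x))" by blast
qed

section \<open>Predicates and case distinction\<close>

definition poly_time_pred :: "(tree \<Rightarrow> bool) \<Rightarrow> bool" where
  "poly_time_pred P \<longleftrightarrow> poly_time_fun (\<lambda>x. enc_bool (P x))"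

lemma poly_time_pred_eq:
  assumes "poly_time_fun f" "poly_time_fun g"
  shows "poly_time_pred (\<lambda>x. f x = g x)"
proof -
  \<comment> \<open>Both values are packed into one tree because \<open>poly_time_fun_expr\<close>
    concerns expressions in a single variable. Each projection costs at most twice the size of the
    tree, and the truth value has size at most 3.\<close>
  have "expr_cost (EqE (HdE (VarE i)) (TlE (VarE i))) s \<le> 7 * tsize (s i)" for i s
    using tsize_hd_tree[of "s i"] tsize_tl_tree[of "s i"] tsize_pos[of "s i"]
      tsize_enc_bool[of "hd_tree (s i) = tl_tree (s i)"]
    by simp
  then have "poly_time_fun (\<lambda>x. enc_bool (hd_tree x = tl_tree x))"
    by (intro poly_time_fun_expr[where e = "\<lambda>i. EqE (HdE (VarE i)) (TlE (VarE i))" and k = 7])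
      simp_all
  from poly_time_fun_comp[OF this poly_time_fun_Node[OF assms]] show ?thesis
    by (simp add: poly_time_pred_def)
qed

lemma poly_time_fun_if:
  assumes P: "poly_time_pred P" and f: "poly_time_fun f" and g: "poly_time_fun g"
  shows "poly_time_fun (\<lambda>x. if P x then f x else g x)"
  unfolding poly_time_fun_def
proof (intro allI impI)
  fix n i j :: nat
  assume ij: "i < n" "j < n"
  obtain b o' where b: "computes (Suc n) i n b o' (\<lambda>x. enc_bool (P x))"
    by (rule poly_time_funD[OF P[unfolded poly_time_pred_def], of i "Suc n" n]) (use ij in auto)
  obtain c p where c: "computes (Suc n) i j c p f"
    by (rule poly_time_funD[OF f, of i "Suc n" j]) (use ij in auto)
  obtain d q where d: "computes (Suc n) i j d q g"
    by (rule poly_time_funD[OF g, of i "Suc n" j]) (use ij in auto)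
  let ?c = "Seq b (Cond (VarE n) c d)"
  let ?p = "[:4:] + o' + p + q"
  have "computes n i j ?c ?p (\<lambda>x. if P x then f x else g x)"
    unfolding computes_def
  proof (intro conjI allI)
    fix s r
    obtain t s1 where 1: "exec b (s, r) t (s1, r)"
      "t + tsize (enc_bool (P (s i))) \<le> poly o' (tsize (s i))"
      "s1 n = enc_bool (P (s i))" "\<And>x. x < Suc n \<Longrightarrow> x \<noteq> n \<Longrightarrow> s1 x = s x"
      by (rule computesE[OF b, where s = s and r = r]) (rule that)
    obtain t' s2 where 2: "exec c (s1, r) t' (s2, r)"
      "t' + tsize (f (s1 i)) \<le> poly p (tsize (s1 i))"
      "s2 j = f (s1 i)" "\<And>x. x < Suc n \<Longrightarrow> x \<noteq> j \<Longrightarrow> s2 x = s1 x"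
      by (rule computesE[OF c, where s = s1 and r = r]) (rule that)
    obtain t'' s3 where 3: "exec d (s1, r) t'' (s3, r)"
      "t'' + tsize (g (s1 i)) \<le> poly q (tsize (s1 i))"
      "s3 j = g (s1 i)" "\<And>x. x < Suc n \<Longrightarrow> x \<noteq> j \<Longrightarrow> s3 x = s1 x"
      by (rule computesE[OF d, where s = s1 and r = r]) (rule that)
    have [simp]: "s1 i = s i" using 1 ij by auto
    show "\<exists>t s'. exec ?c (s, r) t (s', r) \<and>
        t + tsize (if P (s i) then f (s i) else g (s i)) \<le> poly ?p (tsize (s i)) \<and>
        s' j = (if P (s i) then f (s i) else g (s i)) \<and> (\<forall>x<n. x \<noteq> j \<longrightarrow> s' x = s x)"
    proof (cases "P (s i)")
      case True
      then have "exec ?c (s, r) (t + (1 + expr_cost (VarE n) s1 + t')) (s2, r)"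
        using 1 2 by (intro exec.Seq[OF 1(1)] exec.CondTrue) (auto simp: enc_bool_eq_Leaf)
      moreover have "(t + (1 + expr_cost (VarE n) s1 + t')) + tsize (f (s i))
          \<le> poly ?p (tsize (s i))"
        using 1(2,3) 2(2) by simp
      ultimately show ?thesis using 1 2 True
        by (intro exI[of _ "t + (1 + expr_cost (VarE n) s1 + t')"] exI[of _ s2]) auto
    next
      case False
      then have "exec ?c (s, r) (t + (1 + expr_cost (VarE n) s1 + t'')) (s3, r)"
        using 1 3 by (intro exec.Seq[OF 1(1)] exec.CondFalse) (auto simp: enc_bool_eq_Leaf)
      moreover have "(t + (1 + expr_cost (VarE n) s1 + t'')) + tsize (g (s i))
          \<le> poly ?p (tsize (s i))"
        using 1(2,3) 3(2) by simp
      ultimately show ?thesis using 1 3 False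
        by (intro exI[of _ "t + (1 + expr_cost (VarE n) s1 + t'')"] exI[of _ s3]) auto
    qed
  qed (use computes_coin_free[OF b] computes_coin_free[OF c] computes_coin_free[OF d] in simp)
  then show "\<exists>c p. computes n i j c p (\<lambda>x. if P x then f x else g x)" by blast
qed

lemma poly_time_pred_const: "poly_time_pred (\<lambda>x. b)"
  by (cases b) (auto simp: poly_time_pred_def enc_bool_def
      intro: poly_time_fun_Node poly_time_fun_Leaf)

lemma poly_time_pred_if:
  assumes "poly_time_pred P" "poly_time_pred Q" "poly_time_pred R"
  shows "poly_time_pred (\<lambda>x. if P x then Q x else R x)"
  using poly_time_fun_if[OF assms(1) assms(2,3)[unfolded poly_time_pred_def]]
  by (simp add: poly_time_pred_def if_distrib)

lemma poly_time_pred_not: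
  assumes "poly_time_pred P"
  shows "poly_time_pred (\<lambda>x. \<not> P x)"
proof -
  have "(\<lambda>x. \<not> P x) = (\<lambda>x. if P x then False else True)" by auto
  then show ?thesis
    using poly_time_pred_if[OF assms poly_time_pred_const[of False] poly_time_pred_const[of True]]
    by simp
qed

lemma poly_time_pred_conj:
  assumes "poly_time_pred P" "poly_time_pred Q"
  shows "poly_time_pred (\<lambda>x. P x \<and> Q x)"
proof -
  have "(\<lambda>x. P x \<and> Q x) = (\<lambda>x. if P x then Q x else False)" by auto
  then show ?thesis using poly_time_pred_if[OF assms poly_time_pred_const[of False]] by simp
qed

lemma poly_time_pred_disj:
  assumes "poly_time_pred P" "poly_time_pred Q"
  shows "poly_time_pred (\<lambda>x. P x \<or> Q x)"
proof -
  have "(\<lambda>x. P x \<or> Q x) = (\<lambda>x. if P x then True else Q x)" by auto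
  then show ?thesis using poly_time_pred_if[OF assms(1) poly_time_pred_const[of True] assms(2)]
    by simp
qed

lemma poly_time_fun_enc_bool: "poly_time_pred P \<Longrightarrow> poly_time_fun (\<lambda>x. enc_bool (P x))"
  by (simp add: poly_time_pred_def)

subsection \<open>Iteration over lists\<close>

text \<open>Every tree is read as the list along its right spine. This inverts
  \<open>enc_list\<close> up to the encoding of the entries and is total, so the functions below
  need no assumption that their input is well formed.\<close>

fun items :: "tree \<Rightarrow> tree list" where
  "items Leaf = []"
| "items (Node x y) = x # items y"

abbreviation tree_of_list :: "tree list \<Rightarrow> tree" where
  "tree_of_list \<equiv> enc_list (\<lambda>x. x)"

lemma items_enc_list: "items (enc_list f xs) = map f xs"
  by (induction xs) auto

lemma enc_list_map: "enc_list f xs = tree_of_list (map f xs)"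
  by (induction xs) auto

lemma length_items_le: "length (items x) \<le> tsize x"
  by (induction x) auto

lemma tsize_items_le: "y \<in> set (items x) \<Longrightarrow> tsize y \<le> tsize x"
  by (induction x) auto

text \<open>A polynomial number of polynomial-time steps may still square the accumulator each time.
  The growth condition excludes this: each step adds at most an amount depending on \<open>z\<close>
  alone, so all accumulators stay polynomial. The step function gets its arguments packed as
  \<open>Node z (Node a x)\<close>, hence the projections.\<close>

lemma poly_time_fun_fold:
  fixes F :: "tree \<Rightarrow> tree \<Rightarrow> tree \<Rightarrow> tree"
  assumes F: "poly_time_fun (\<lambda>w. F (hd_tree w) (tl_tree (tl_tree w)) (hd_tree (tl_tree w)))"
    and l: "poly_time_fun l" and b: "poly_time_fun b"
    and growth: "\<exists>g. \<forall>z a. \<forall>x\<in>set (items (l z)). tsize (F z x a) \<le> tsize a + poly g (tsize z)"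
  shows "poly_time_fun (\<lambda>z. fold (F z) (items (l z)) (b z))"
  unfolding poly_time_fun_def
proof (intro allI impI)
  fix n i j :: nat
  assume ij: "i < n" "j < n"
  \<comment> \<open>\<open>L\<close> holds the remaining list, \<open>A\<close> the accumulator, and
    \<open>W\<close> the packed argument of the step function.\<close>
  define L where "L = n"
  define A where "A = Suc n"
  define W where "W = Suc (Suc n)"
  note LAW = L_def A_def W_def
  let ?n = "n + 3"
  obtain c p where c: "computes ?n i L c p l"
    by (rule poly_time_funD[OF l, of i ?n L]) (use ij LAW in auto)
  obtain d q where d: "computes ?n i A d q b"
    by (rule poly_time_funD[OF b, of i ?n A]) (use ij LAW in auto)
  obtain e h where e: "computes ?n W A e h
      (\<lambda>w. F (hd_tree w) (tl_tree (tl_tree w)) (hd_tree (tl_tree w)))"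
    by (rule poly_time_funD[OF F, of W ?n A]) (use LAW in auto)
  obtain g where g: "\<And>z a x. x \<in> set (items (l z)) \<Longrightarrow> tsize (F z x a) \<le> tsize a + poly g (tsize z)"
    using growth by blast
  define eW where "eW = ConsE (VarE i) (ConsE (VarE A) (HdE (VarE L)))"
  define body where "body = Seq (Assign W eW) (Seq e (Assign L (TlE (VarE L))))"
  define loop where "loop = While (VarE L) body"
  \<comment> \<open>The last assumption adds to the accumulator all growth that the remaining items
    may still cause; an iteration does not increase this sum, so one \<open>M\<close> serves
    throughout. The packed argument has size at most \<open>3 * M + 2\<close>, and the final 2 pays
    for the failing loop test.\<close>
  have loop: "\<exists>t s'. exec loop (s, r) t (s', r) \<and>
        t \<le> length (items (s L)) * (15 * M + 15 + poly h (3 * M + 2)) + 2 \<and>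
        s' A = fold (F z) (items (s L)) (s A) \<and> tsize (s' A) \<le> M \<and>
        (\<forall>x<n. s' x = s x)"
    if "s i = z" "set (items (s L)) \<subseteq> set (items (l z))" "tsize z \<le> M" "tsize (s L) \<le> M"
      "tsize (s A) + length (items (s L)) * poly g (tsize z) \<le> M" for s r z M
    using that
  proof (induction "items (s L)" arbitrary: s)
    case Nil
    then have sL: "s L = Leaf" by (cases "s L") auto
    have "exec loop (s, r) (1 + expr_cost (VarE L) s) (s, r)"
      unfolding loop_def by (rule exec.WhileFalse) (simp add: sL)
    then show ?case using Nil sL
      by (intro exI[of _ "1 + expr_cost (VarE L) s"] exI[of _ s]) auto
  next
    case (Cons x xs)
    then obtain y where sL: "s L = Node x y" and xs: "xs = items y"
      by (cases "s L") auto
    define s1 where "s1 = s(W := value_of eW s)"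
    have W: "s1 W = Node z (Node (s A) x)" by (simp add: s1_def eW_def sL Cons.prems)
    obtain t s2 where 2: "exec e (s1, r) t (s2, r)"
      "t + tsize (F z x (s A)) \<le> poly h (tsize (s1 W))"
      "s2 A = F z x (s A)" "\<And>x. x < ?n \<Longrightarrow> x \<noteq> A \<Longrightarrow> s2 x = s1 x"
      by (rule computesE[OF e, of s1 r]) (simp add: W)
    define s3 where "s3 = s2(L := y)"
    have s2: "s2 L = Node x y" "\<And>x. x < n \<Longrightarrow> s2 x = s x"
      using 2(4) by (auto simp: s1_def LAW sL[unfolded LAW])
    have s3: "s3 L = y" "s3 A = F z x (s A)" "\<And>x. x < n \<Longrightarrow> s3 x = s x"
      using s2 2(3) by (auto simp: s3_def LAW)
    have body: "exec body (s, r) ((1 + expr_cost eW s) + (t + (1 + expr_cost (TlE (VarE L)) s2)))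
        (s3, r)"
    proof -
      have "exec (Assign L (TlE (VarE L))) (s2, r) (1 + expr_cost (TlE (VarE L)) s2) (s3, r)"
        using exec.Assign[of L "TlE (VarE L)" s2 r] by (simp add: s3_def s2)
      from exec.Seq[OF exec.Assign[of W eW s r] exec.Seq[OF 2(1)[unfolded s1_def] this]]
      show ?thesis unfolding body_def .
    qed
    have x: "x \<in> set (items (l z))" using Cons.prems sL by auto
    have grow: "tsize (s A) \<le> M" "tsize (F z x (s A)) + length xs * poly g (tsize z) \<le> M"
      using Cons.prems(5) g[OF x, of "s A"] by (auto simp: sL xs)
    obtain t' s' where IH: "exec loop (s3, r) t' (s', r)"
        "t' \<le> length xs * (15 * M + 15 + poly h (3 * M + 2)) + 2"
        "s' A = fold (F z) xs (F z x (s A))" "tsize (s' A) \<le> M" "\<And>x. x < n \<Longrightarrow> s' x = s3 x"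
      using Cons.hyps(1)[of s3] Cons.prems s3 grow xs sL ij by auto
    let ?t = "1 + expr_cost (VarE L) s
      + ((1 + expr_cost eW s) + (t + (1 + expr_cost (TlE (VarE L)) s2))) + t'"
    have "exec loop (s, r) ?t (s', r)"
      unfolding loop_def using body IH(1)[unfolded loop_def]
      by (intro exec.WhileTrue) (simp_all add: sL)
    moreover have "tsize (s1 W) \<le> 3 * M + 2"
      using Cons.prems grow by (simp add: W sL)
    then have "t \<le> poly h (3 * M + 2)"
      using 2(2) poly_nat_mono[of "tsize (s1 W)" "3 * M + 2" h] by simp
    then have "?t \<le> length (items (s L)) * (15 * M + 15 + poly h (3 * M + 2)) + 2"
      using IH(2) Cons.prems grow by (simp add: sL xs eW_def s2)
    ultimately show ?case
      using IH s3 by (intro exI[of _ ?t] exI[of _ s']) (auto simp: sL xs)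
  qed
  let ?c = "Seq c (Seq d (Seq loop (Assign j (VarE A))))"
  \<comment> \<open>The summands bound the input, the list, the initial accumulator, and the growth
    over at most \<open>p\<close> items.\<close>
  define M where "M = [:0, 1:] + p + q + p * g"
  let ?p = "p + q + (p * ([:15:] * M + [:15:] + pcompose h ([:3:] * M + [:2:])) + [:2:])
    + ([:1:] + [:2:] * M)"
  have "computes n i j ?c ?p (\<lambda>z. fold (F z) (items (l z)) (b z))"
    unfolding computes_def
  proof (intro conjI allI)
    fix s r
    obtain t1 s1 where 1: "exec c (s, r) t1 (s1, r)" "t1 + tsize (l (s i)) \<le> poly p (tsize (s i))"
      "s1 L = l (s i)" "\<And>x. x < ?n \<Longrightarrow> x \<noteq> L \<Longrightarrow> s1 x = s x"
      by (rule computesE[OF c, where s = s and r = r]) (rule that)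
    obtain t2 s2 where 2: "exec d (s1, r) t2 (s2, r)"
      "t2 + tsize (b (s1 i)) \<le> poly q (tsize (s1 i))"
      "s2 A = b (s1 i)" "\<And>x. x < ?n \<Longrightarrow> x \<noteq> A \<Longrightarrow> s2 x = s1 x"
      by (rule computesE[OF d, where s = s1 and r = r]) (rule that)
    define m where "m = poly M (tsize (s i))"
    have s: "s1 i = s i" "s2 i = s i" "s2 L = l (s i)" "s2 A = b (s i)"
        "\<And>x. x < n \<Longrightarrow> s2 x = s x"
      using 1(3,4) 2(3,4) ij by (auto simp: LAW)
    have len: "length (items (l (s i))) \<le> poly p (tsize (s i))"
      using length_items_le[of "l (s i)"] 1(2) by simp
    then have prod: "length (items (l (s i))) * poly g (tsize (s i))
        \<le> poly p (tsize (s i)) * poly g (tsize (s i))"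
      by (rule mult_right_mono) simp
    have "tsize (s2 i) \<le> m" "tsize (s2 L) \<le> m"
      using s 1(2) by (simp_all add: m_def M_def)
    moreover have "tsize (b (s i)) \<le> poly q (tsize (s i))" using s 2(2) by simp
    from add_mono[OF this prod]
    have "tsize (s2 A) + length (items (s2 L)) * poly g (tsize (s i)) \<le> m"
      unfolding s by (rule order_trans) (simp add: m_def M_def)
    ultimately have "\<exists>t3 s3. exec loop (s2, r) t3 (s3, r) \<and>
        t3 \<le> length (items (s2 L)) * (15 * m + 15 + poly h (3 * m + 2)) + 2 \<and>
        s3 A = fold (F (s i)) (items (s2 L)) (s2 A) \<and> tsize (s3 A) \<le> m \<and>
        (\<forall>x<n. s3 x = s2 x)"
      using s by (intro loop) simp_all
    then obtain t3 s3 where 3: "exec loop (s2, r) t3 (s3, r)"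
        "t3 \<le> length (items (l (s i))) * (15 * m + 15 + poly h (3 * m + 2)) + 2"
        "s3 A = fold (F (s i)) (items (l (s i))) (b (s i))" "tsize (s3 A) \<le> m"
        "\<And>x. x < n \<Longrightarrow> s3 x = s x"
      unfolding s by (metis s(5))
    let ?t = "t1 + (t2 + (t3 + (1 + expr_cost (VarE A) s3)))"
    have "exec ?c (s, r) ?t (s3(j := value_of (VarE A) s3), r)"
      by (intro exec.Seq[OF 1(1)] exec.Seq[OF 2(1)] exec.Seq[OF 3(1)] exec.Assign)
    moreover have "t3 \<le> poly p (tsize (s i)) * (15 * m + 15 + poly h (3 * m + 2)) + 2"
      using 3(2) mult_right_mono[OF len] by (meson add_right_mono order_trans zero_le)
    then have "?t + tsize (fold (F (s i)) (items (l (s i))) (b (s i))) \<le> poly ?p (tsize (s i))"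
      using 1(2) 2(2) 3(3,4) s by (simp add: m_def[symmetric] poly_pcompose)
    ultimately show "\<exists>t s'. exec ?c (s, r) t (s', r) \<and>
        t + tsize (fold (F (s i)) (items (l (s i))) (b (s i))) \<le> poly ?p (tsize (s i)) \<and>
        s' j = fold (F (s i)) (items (l (s i))) (b (s i)) \<and> (\<forall>x<n. x \<noteq> j \<longrightarrow> s' x = s x)"
      using 3 by (intro exI[of _ ?t] exI[of _ "s3(j := value_of (VarE A) s3)"]) auto
  qed (use computes_coin_free[OF c] computes_coin_free[OF d] computes_coin_free[OF e]
      in \<open>simp add: loop_def body_def\<close>)
  then show "\<exists>c p. computes n i j c p (\<lambda>z. fold (F z) (items (l z)) (b z))" by blast
qed

text \<open>Supplies the growth condition of \<open>poly_time_fun_fold\<close> when the step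
  prepends \<open>F z x\<close> to a list: an item is no larger than the list containing it.\<close>

lemma item_image_size:
  assumes F: "poly_time_fun (\<lambda>w. F (hd_tree w) (tl_tree w))" and l: "poly_time_fun l"
  obtains g where "\<And>z x. x \<in> set (items (l z)) \<Longrightarrow> tsize (F z x) \<le> poly g (tsize z)"
proof -
  obtain p where p: "\<And>w. tsize (F (hd_tree w) (tl_tree w)) \<le> poly p (tsize w)"
    by (rule poly_time_fun_size[OF F]) (rule that)
  obtain q where q: "\<And>z. tsize (l z) \<le> poly q (tsize z)"
    by (rule poly_time_fun_size[OF l]) (rule that)
  have "tsize (F z x) \<le> poly (pcompose p ([:1, 1:] + q)) (tsize z)"
    if "x \<in> set (items (l z))" for z x
  proof -
    have "tsize (Node z x) \<le> poly ([:1, 1:] + q) (tsize z)"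
      using tsize_items_le[OF that] q[of z] by simp
    from poly_nat_mono[OF this, of p] show ?thesis
      using p[of "Node z x"] by (simp add: poly_pcompose)
  qed
  then show ?thesis by (rule that)
qed

lemma fold_Node: "fold Node xs (tree_of_list ys) = tree_of_list (rev xs @ ys)"
proof (induction xs arbitrary: ys)
  case (Cons x xs)
  show ?case using Cons[of "x # ys"] by simp
qed simp

lemma poly_time_fun_rev:
  assumes "poly_time_fun l"
  shows "poly_time_fun (\<lambda>z. tree_of_list (rev (items (l z))))"
proof -
  obtain g where g: "\<And>z x. x \<in> set (items (l z)) \<Longrightarrow> tsize x \<le> poly g (tsize z)"
    using item_image_size[OF poly_time_fun_tl[OF poly_time_fun_id] assms] by blast
  have "poly_time_fun (\<lambda>z. fold Node (items (l z)) Leaf)"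
  proof (rule poly_time_fun_fold[where F = "\<lambda>z. Node", OF _ assms poly_time_fun_Leaf])
    show "\<exists>g. \<forall>z a. \<forall>x\<in>set (items (l z)). tsize (Node x a) \<le> tsize a + poly g (tsize z)"
      using g by (intro exI[of _ "[:1:] + g"]) fastforce
  qed (intro poly_time_fun_Node poly_time_fun_hd poly_time_fun_tl poly_time_fun_id)
  then show ?thesis using fold_Node[of _ "[]"] by simp
qed

text \<open>A loop consumes the list from the front, and prepending results would reverse it;
  reversing the list first keeps the order.\<close>

lemma poly_time_fun_foldr:
  fixes F :: "tree \<Rightarrow> tree \<Rightarrow> tree \<Rightarrow> tree"
  assumes F: "poly_time_fun (\<lambda>w. F (hd_tree w) (tl_tree (tl_tree w)) (hd_tree (tl_tree w)))"
    and l: "poly_time_fun l" and b: "poly_time_fun b"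
    and growth: "\<exists>g. \<forall>z a. \<forall>x\<in>set (items (l z)). tsize (F z x a) \<le> tsize a + poly g (tsize z)"
  shows "poly_time_fun (\<lambda>z. foldr (F z) (items (l z)) (b z))"
  using poly_time_fun_fold[OF F poly_time_fun_rev[OF l] b] growth
  by (simp add: items_enc_list foldr_conv_fold)

text \<open>Mediates between the argument \<open>Node z x\<close> of a map and the argument
  \<open>Node z (Node a x)\<close> of a fold by forgetting the accumulator.\<close>

lemma poly_time_fun_drop_acc:
  assumes "poly_time_fun (\<lambda>w. F (hd_tree w) (tl_tree w))"
  shows "poly_time_fun (\<lambda>w. F (hd_tree w) (tl_tree (tl_tree w)))"
proof -
  have "poly_time_fun (\<lambda>w. Node (hd_tree w) (tl_tree (tl_tree w)))"
    by (intro poly_time_fun_Node poly_time_fun_hd poly_time_fun_tl poly_time_fun_id)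
  from poly_time_fun_comp[OF assms this] show ?thesis by simp
qed

lemma poly_time_fun_map:
  assumes F: "poly_time_fun (\<lambda>w. F (hd_tree w) (tl_tree w))" and l: "poly_time_fun l"
  shows "poly_time_fun (\<lambda>z. tree_of_list (map (F z) (items (l z))))"
proof -
  obtain g where g: "\<And>z x. x \<in> set (items (l z)) \<Longrightarrow> tsize (F z x) \<le> poly g (tsize z)"
    by (rule item_image_size[OF F l]) (rule that)
  have "poly_time_fun (\<lambda>z. foldr (\<lambda>x. Node (F z x)) (items (l z)) Leaf)"
  proof (rule poly_time_fun_foldr[where F = "\<lambda>z x. Node (F z x)", OF _ l poly_time_fun_Leaf])
    show "\<exists>g. \<forall>z a. \<forall>x\<in>set (items (l z)). tsize (Node (F z x) a) \<le> tsize a + poly g (tsize z)"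
      using g by (intro exI[of _ "[:1:] + g"]) fastforce
  qed (intro poly_time_fun_Node poly_time_fun_hd poly_time_fun_tl poly_time_fun_id
      poly_time_fun_drop_acc F)
  moreover have "foldr (\<lambda>x. Node (F z x)) xs Leaf = tree_of_list (map (F z) xs)" for z xs
    by (induction xs) auto
  ultimately show ?thesis by simp
qed

lemma poly_time_fun_map_pairs:
  assumes F: "poly_time_fun (\<lambda>w. F (hd_tree w) (tl_tree w))"
    and G: "poly_time_fun (\<lambda>w. G (hd_tree w) (tl_tree w))" and l: "poly_time_fun l"
  shows "poly_time_fun (\<lambda>z. tree_of_list (concat (map (\<lambda>x. [F z x, G z x]) (items (l z)))))"
proof -
  obtain f where f: "\<And>z x. x \<in> set (items (l z)) \<Longrightarrow> tsize (F z x) \<le> poly f (tsize z)"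
    by (rule item_image_size[OF F l]) (rule that)
  obtain g where g: "\<And>z x. x \<in> set (items (l z)) \<Longrightarrow> tsize (G z x) \<le> poly g (tsize z)"
    by (rule item_image_size[OF G l]) (rule that)
  have "poly_time_fun (\<lambda>z. foldr (\<lambda>x a. Node (F z x) (Node (G z x) a)) (items (l z)) Leaf)"
  proof (rule poly_time_fun_foldr[where F = "\<lambda>z x a. Node (F z x) (Node (G z x) a)",
        OF _ l poly_time_fun_Leaf])
    have "tsize (Node (F z x) (Node (G z x) a)) \<le> tsize a + poly ([:2:] + f + g) (tsize z)"
      if "x \<in> set (items (l z))" for z x a
      using f[OF that] g[OF that] by simp
    then show "\<exists>g. \<forall>z a. \<forall>x\<in>set (items (l z)).
        tsize (Node (F z x) (Node (G z x) a)) \<le> tsize a + poly g (tsize z)"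
      by blast
  qed (intro poly_time_fun_Node poly_time_fun_hd poly_time_fun_tl poly_time_fun_id
      poly_time_fun_drop_acc F G)
  moreover have "foldr (\<lambda>x a. Node (F z x) (Node (G z x) a)) xs Leaf
      = tree_of_list (concat (map (\<lambda>x. [F z x, G z x]) xs))" for z xs
    by (induction xs) auto
  ultimately show ?thesis by simp
qed

lemma poly_time_pred_mem:
  assumes f: "poly_time_fun f" and l: "poly_time_fun l"
  shows "poly_time_pred (\<lambda>z. f z \<in> set (items (l z)))"
proof -
  have "poly_time_fun (\<lambda>z. fold (\<lambda>x a. if f z = x then Node Leaf Leaf else a) (items (l z)) Leaf)"
  proof (rule poly_time_fun_fold[where F = "\<lambda>z x a. if f z = x then Node Leaf Leaf else a",
        OF _ l poly_time_fun_Leaf])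
    show "\<exists>g. \<forall>z a. \<forall>x\<in>set (items (l z)).
        tsize (if f z = x then Node Leaf Leaf else a) \<le> tsize a + poly g (tsize z)"
      by (intro exI[of _ "[:3:]"]) auto
  qed (intro poly_time_fun_if poly_time_pred_eq poly_time_fun_comp[OF f]
      poly_time_fun_Node poly_time_fun_hd poly_time_fun_tl poly_time_fun_id poly_time_fun_Leaf)
  moreover have "fold (\<lambda>x a. if y = x then Node Leaf Leaf else a) xs a
      = (if y \<in> set xs then Node Leaf Leaf else a)" for y :: tree and xs a
    by (induction xs arbitrary: a) auto
  ultimately show ?thesis by (simp only: poly_time_pred_def enc_bool_def)
qed

text \<open>Two lists are traversed by one loop: the accumulator pairs a success flag with the
  unread part of the second list. The flag is lost if the second list ends early, and a nonempty
  rest at the end reveals that it is too long.\<close>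

lemma fold_list_all2:
  fixes P :: "tree \<Rightarrow> tree \<Rightarrow> bool"
  defines "step \<equiv> \<lambda>x a. Node (enc_bool (hd_tree a \<noteq> Leaf \<and> tl_tree a \<noteq> Leaf \<and> P x (hd_tree (tl_tree a))))
      (tl_tree (tl_tree a))"
  shows "hd_tree (fold step xs (Node (enc_bool b) y)) \<noteq> Leaf \<and>
      tl_tree (fold step xs (Node (enc_bool b) y)) = Leaf \<longleftrightarrow> b \<and> list_all2 P xs (items y)"
proof (induction xs arbitrary: b y)
  case Nil
  then show ?case by (cases y) (auto simp: enc_bool_eq_Leaf)
next
  case (Cons x xs)
  have "step x (Node (enc_bool b) y)
      = Node (enc_bool (b \<and> y \<noteq> Leaf \<and> P x (hd_tree y))) (tl_tree y)"
    by (simp add: step_def enc_bool_eq_Leaf)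
  with Cons show ?case by (cases y) auto
qed

lemma poly_time_pred_list_all2:
  assumes P: "poly_time_pred (\<lambda>w. P (hd_tree w) (hd_tree (tl_tree w)) (tl_tree (tl_tree w)))"
    and l: "poly_time_fun l" and m: "poly_time_fun m"
  shows "poly_time_pred (\<lambda>z. list_all2 (P z) (items (l z)) (items (m z)))"
proof -
  let ?step = "\<lambda>z x a. Node
    (enc_bool (hd_tree a \<noteq> Leaf \<and> tl_tree a \<noteq> Leaf \<and> P z x (hd_tree (tl_tree a))))
    (tl_tree (tl_tree a))"
  \<comment> \<open>Repacks the fold argument \<open>Node z (Node a x)\<close>, where
    \<open>a\<close> consists of flag and rest, into \<open>z\<close>, \<open>x\<close> and the head
    of the rest.\<close>
  have "poly_time_fun (\<lambda>w. Node (hd_tree w) (Node (tl_tree (tl_tree w))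
      (hd_tree (tl_tree (hd_tree (tl_tree w))))))"
    by (intro poly_time_fun_Node poly_time_fun_hd poly_time_fun_tl poly_time_fun_id)
  from poly_time_fun_comp[OF P[unfolded poly_time_pred_def] this]
  have P': "poly_time_pred (\<lambda>w. P (hd_tree w) (tl_tree (tl_tree w))
      (hd_tree (tl_tree (hd_tree (tl_tree w)))))"
    by (simp add: poly_time_pred_def)
  have fold: "poly_time_fun
      (\<lambda>z. fold (?step z) (items (l z)) (Node (enc_bool True) (m z)))"
  proof (rule poly_time_fun_fold[where F = ?step, OF _ l])
    have "tsize (?step z x a) \<le> tsize a + poly [:4:] (tsize z)" for z x a
      using tsize_enc_bool[of "hd_tree a \<noteq> Leaf \<and> tl_tree a \<noteq> Leaf \<and> P z x (hd_tree (tl_tree a))"]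
        tsize_tl_tree[of a] tsize_tl_tree[of "tl_tree a"] by simp
    then show "\<exists>g. \<forall>z a. \<forall>x\<in>set (items (l z)). tsize (?step z x a) \<le> tsize a + poly g (tsize z)"
      by blast
  qed (intro poly_time_fun_enc_bool poly_time_pred_conj poly_time_pred_not poly_time_pred_eq P' m
      poly_time_fun_Node poly_time_fun_hd poly_time_fun_tl poly_time_fun_id poly_time_fun_Leaf
      poly_time_pred_const)+
  have "poly_time_pred (\<lambda>z.
      hd_tree (fold (?step z) (items (l z)) (Node (enc_bool True) (m z))) \<noteq> Leaf \<and>
      tl_tree (fold (?step z) (items (l z)) (Node (enc_bool True) (m z))) = Leaf)"
    by (intro poly_time_pred_conj poly_time_pred_not poly_time_pred_eq
        poly_time_fun_hd[OF fold] poly_time_fun_tl[OF fold] poly_time_fun_Leaf)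
  then show ?thesis unfolding fold_list_all2 by simp
qed

section \<open>Polynomial-time reductions with one query\<close>

fun expr_vars :: "expr \<Rightarrow> nat set" where
  "expr_vars (VarE x) = {x}"
| "expr_vars NilE = {}"
| "expr_vars (ConsE a b) = expr_vars a \<union> expr_vars b"
| "expr_vars (HdE a) = expr_vars a"
| "expr_vars (TlE a) = expr_vars a"
| "expr_vars (EqE a b) = expr_vars a \<union> expr_vars b"

fun com_vars :: "com \<Rightarrow> nat set" where
  "com_vars Skip = {}"
| "com_vars (Assign x e) = insert x (expr_vars e)"
| "com_vars (Flip x) = {x}"
| "com_vars (Seq c d) = com_vars c \<union> com_vars d"
| "com_vars (Cond e c d) = expr_vars e \<union> com_vars c \<union> com_vars d"
| "com_vars (While e c) = expr_vars e \<union> com_vars c"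

lemma finite_expr_vars: "finite (expr_vars e)"
  by (induction e) auto

lemma finite_com_vars: "finite (com_vars c)"
  by (induction c) (auto simp: finite_expr_vars)

lemma value_of_cong: "(\<And>x. x \<in> expr_vars e \<Longrightarrow> s x = s' x) \<Longrightarrow> value_of e s = value_of e s'"
  by (induction e) auto

lemma expr_cost_cong: "(\<And>x. x \<in> expr_vars e \<Longrightarrow> s x = s' x) \<Longrightarrow> expr_cost e s = expr_cost e s'"
proof (induction e)
  case (ConsE a b)
  then show ?case using value_of_cong[of "ConsE a b" s s'] by (auto simp del: value_of.simps)
next
  case (HdE a)
  then show ?case using value_of_cong[of "HdE a" s s'] by (auto simp del: value_of.simps)
next
  case (TlE a)
  then show ?case using value_of_cong[of "TlE a" s s'] by (auto simp del: value_of.simps)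
next
  case (EqE a b)
  then show ?case using value_of_cong[of "EqE a b" s s'] by (auto simp del: value_of.simps)
qed auto

lemma override_on_expr:
  assumes "expr_vars e \<subseteq> A"
  shows "value_of e (override_on u s A) = value_of e s"
    and "expr_cost e (override_on u s A) = expr_cost e s"
  using assms by (auto intro!: value_of_cong expr_cost_cong)

lemma override_on_upd: "x \<in> A \<Longrightarrow> override_on u (s(x := v)) A = (override_on u s A)(x := v)"
  by (auto simp: override_on_def)

text \<open>A program neither reads nor writes outside \<open>com_vars c\<close>, so arbitrary data
  kept there survives and leaves the time unchanged. This allows an algorithm that expects a clean
  store to be called in the middle of another one.\<close>

lemma exec_override_on:
  assumes "exec c (s, r) t (s', r')" "com_vars c \<subseteq> A"
  shows "exec c (override_on u s A, r) t (override_on u s' A, r')"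
  using assms
proof (induction c "(s, r)" t "(s', r')" arbitrary: s r s' r' rule: exec.induct)
  case (Skip s r)
  show ?case by (rule exec.Skip)
next
  case (Assign x e s r)
  then show ?case
    using exec.Assign[of x e "override_on u s A" r] by (simp add: override_on_expr override_on_upd)
next
  case (Flip x s b r)
  then show ?case using exec.Flip[of x "override_on u s A" b r] by (simp add: override_on_upd)
next
  case (Seq c s r t s' r' d t' s'' r'')
  then show ?case by (auto intro: exec.Seq)
next
  case (CondTrue e s c r t s' r' d)
  then show ?case
    using exec.CondTrue[of e "override_on u s A"] by (simp add: override_on_expr)
next
  case (CondFalse e s d r t s' r' c)
  then show ?case
    using exec.CondFalse[of e "override_on u s A"] by (simp add: override_on_expr)
next
  case (WhileFalse e s c r)
  then show ?case
    using exec.WhileFalse[of e "override_on u s A"] by (simp add: override_on_expr)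
next
  case (WhileTrue e s c r t s' r' t' s'' r'')
  then have "exec (While e c) (override_on u s A, r)
      (1 + expr_cost e (override_on u s A) + t + t') (override_on u s'' A, r'')"
    by (intro exec.WhileTrue) (auto simp: override_on_expr)
  with WhileTrue.prems show ?case by (simp add: override_on_expr)
qed

lemma exec_append_coins:
  assumes "exec c (s, r) t (s', r')"
  shows "exec c (s, r @ u) t (s', r' @ u)"
  using assms
  by (induction c "(s, r)" t "(s', r')" arbitrary: s r s' r' rule: exec.induct)
    (simp_all only: append_Cons, (blast intro: exec.intros)+)

lemma run_append_coins: "run c x r t y \<Longrightarrow> run c x (r @ u) t y"
  unfolding run_def by (blast intro: exec_append_coins)

text \<open>An assignment creates nothing larger than its cost; a coin toss costs 1 and creates a
  tree of size at most 3, which gives the factor. Only running time is known of the algorithm for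
  BM', so this is how its answer is bounded.\<close>

lemma exec_tsize:
  assumes "exec c (s, r) t (s', r')"
  shows "tsize (s' x) \<le> tsize (s x) + 3 * t"
  using assms
proof (induction c "(s, r)" t "(s', r')" arbitrary: s r s' r' rule: exec.induct)
  case (Assign y e s r)
  then show ?case using tsize_value_of[of e s] by simp
next
  case (Flip y s b r)
  then show ?case using tsize_enc_bool[of b] by simp
qed auto

text \<open>The input \<open>x\<close> is saved in a variable \<open>B\<close> beyond all variables
  of \<open>c\<close>, and \<open>f\<close> is computed with scratch space above \<open>B\<close>.
  After \<open>c\<close> has run, \<open>x\<close> is still available to be paired with the
  answer.\<close>

lemma one_query_program:
  assumes f: "poly_time_fun f" and g: "poly_time_fun g"
  obtains C P where "coin_free c \<Longrightarrow> coin_free C"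
    "\<And>x r t y. run c (f x) r t y \<Longrightarrow>
       \<exists>t'. run C x r t' (g (Node x y)) \<and> t' \<le> poly P (tsize x + t)"
proof -
  obtain B' where "com_vars c \<subseteq> {..<B'}"
    using finite_com_vars[of c] finite_nat_iff_bounded by blast
  then obtain B where B: "com_vars c \<subseteq> {..<B}" "0 < B"
    by (intro that[of "Suc B'"]) auto
  obtain cf pf where cf: "computes (Suc B) B 0 cf pf f"
    by (rule poly_time_funD[OF f, of B "Suc B" 0]) auto
  obtain cg pg where cg: "computes 1 0 0 cg pg g"
    by (rule poly_time_funD[OF g, of 0 1 0]) auto
  let ?e = "ConsE (VarE B) (VarE 0)"
  define C where "C = Seq (Assign B (VarE 0)) (Seq cf (Seq c (Seq (Assign 0 ?e) cg)))"
  \<comment> \<open>Bounds the answer of \<open>c\<close>: the size of its input plus three times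
    its running time.\<close>
  define Y where "Y = pf + [:0, 3:]"
  define P where "P = [:5, 4:] + [:2:] * Y + pf + pcompose pg ([:1, 1:] + Y)"
  show ?thesis
  proof (rule that[of C P])
    show "coin_free C" if "coin_free c"
      using that computes_coin_free[OF cf] computes_coin_free[OF cg] by (simp add: C_def)
  next
    fix x r t y
    assume "run c (f x) r t y"
    then obtain s r' where c: "exec c ((\<lambda>_. Leaf)(0 := f x), r) t (s, r')" and y: "s 0 = y"
      by (auto simp: run_def)
    define s0 where "s0 = ((\<lambda>_. Leaf)(0 := x) :: store)"
    define s1 where "s1 = s0(B := value_of (VarE 0) s0)"
    obtain t1 s2 where 1: "exec cf (s1, r) t1 (s2, r)"
      "t1 + tsize (f (s1 B)) \<le> poly pf (tsize (s1 B))" "s2 0 = f (s1 B)"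
      "\<And>z. z < Suc B \<Longrightarrow> z \<noteq> 0 \<Longrightarrow> s2 z = s1 z"
      by (rule computesE[OF cf, where s = s1 and r = r]) (rule that)
    have s1: "s1 B = x" by (simp add: s1_def s0_def)
    \<comment> \<open>Below \<open>B\<close> only variable 0 has been written, so \<open>c\<close>
      finds exactly the initial store that \<open>run\<close> prescribes.\<close>
    have "override_on s2 ((\<lambda>_. Leaf)(0 := f x)) {..<B} = s2"
      using 1(3,4) s1 B(2) by (auto simp: override_on_def s1_def s0_def)
    with exec_override_on[OF c B(1), of s2]
    have 2: "exec c (s2, r) t (override_on s2 s {..<B}, r')" by simp
    define s3 where "s3 = override_on s2 s {..<B}"
    have s3: "s3 0 = y" "s3 B = x"
      using y B(2) 1(4)[of B] s1 by (auto simp: s3_def override_on_def)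
    define s4 where "s4 = s3(0 := value_of ?e s3)"
    have s4: "s4 0 = Node x y" by (simp add: s4_def s3)
    obtain t3 s5 where 3: "exec cg (s4, r') t3 (s5, r')"
      "t3 + tsize (g (s4 0)) \<le> poly pg (tsize (s4 0))" "s5 0 = g (s4 0)"
      by (rule computesE[OF cg, where s = s4 and r = r']) (rule that)
    let ?t = "(1 + expr_cost (VarE 0) s0) + (t1 + (t + ((1 + expr_cost ?e s3) + t3)))"
    have "exec C (s0, r) ?t (s5, r')"
      unfolding C_def
      by (rule exec.Seq[OF exec.Assign exec.Seq[OF 1(1)[unfolded s1_def]
            exec.Seq[OF 2[folded s3_def] exec.Seq[OF exec.Assign 3(1)[unfolded s4_def]]]]])
    then have "run C x r ?t (g (Node x y))"
      using 3(3) s4 unfolding run_def s0_def by auto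
    moreover have "?t \<le> poly P (tsize x + t)"
    proof -
      let ?N = "tsize x + t"
      have pf: "t1 + tsize (f x) \<le> poly pf ?N"
        using 1(2) poly_nat_mono[of "tsize x" ?N pf] by (simp add: s1)
      have "tsize y \<le> tsize (f x) + 3 * t"
        using exec_tsize[OF c, of 0] y by simp
      with pf have Y: "tsize y \<le> poly Y ?N" by (simp add: Y_def)
      then have "tsize (Node x y) \<le> poly ([:1, 1:] + Y) ?N" by simp
      from poly_nat_mono[OF this, of pg] 3(2)
      have "t3 \<le> poly (pcompose pg ([:1, 1:] + Y)) ?N" by (simp add: poly_pcompose s4)
      then show ?thesis
        using pf Y by (simp add: P_def s3 s0_def)
    qed
    ultimately show "\<exists>t'. run C x r t' (g (Node x y)) \<and> t' \<le> poly P (tsize x + t)" by blast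
  qed
qed

text \<open>Concatenation is a bijection from pairs of strings of lengths \<open>m\<close> and
  \<open>n - m\<close> to strings of length \<open>n\<close>. It turns the uniform distribution into
  a product, whose first marginal is the distribution of the prefix.\<close>

lemma map_pmf_take_pmf_of_set:
  assumes "m \<le> n"
  shows "map_pmf (take m) (pmf_of_set {r :: bool list. length r = n})
    = pmf_of_set {r. length r = m}"
proof -
  let ?L = "\<lambda>n. {r :: bool list. length r = n}"
  have fin: "finite (?L k)" "?L k \<noteq> {}" for k
    using finite_lists_length_eq[of "UNIV :: bool set" k] Ex_list_of_length[of k] by auto
  have inj: "inj_on (\<lambda>(a, b). a @ b) (?L m \<times> ?L (n - m))"
    by (auto simp: inj_on_def)
  have img: "(\<lambda>(a, b). a @ b) ` (?L m \<times> ?L (n - m)) = ?L n"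
  proof (intro equalityI subsetI)
    fix r assume "r \<in> ?L n"
    then show "r \<in> (\<lambda>(a, b). a @ b) ` (?L m \<times> ?L (n - m))"
      using assms by (intro image_eqI[of _ _ "(take m r, drop m r)"]) auto
  qed (use assms in auto)
  have pair: "pmf_of_set (?L m \<times> ?L k) = pair_pmf (pmf_of_set (?L m)) (pmf_of_set (?L k))" for k
    using fin by (intro pmf_eqI) (auto simp: pmf_pair indicator_def card_cartesian_product)
  have "pmf_of_set (?L n) = map_pmf (\<lambda>(a, b). a @ b) (pmf_of_set (?L m \<times> ?L (n - m)))"
    using map_pmf_of_set_inj[OF inj] fin by (simp add: img)
  also have "pmf_of_set (?L m \<times> ?L (n - m)) = pair_pmf (pmf_of_set (?L m)) (pmf_of_set (?L (n - m)))"
    by (rule pair)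
  finally have "map_pmf (take m) (pmf_of_set (?L n))
      = map_pmf (\<lambda>z. take m (fst z @ snd z)) (pair_pmf (pmf_of_set (?L m)) (pmf_of_set (?L (n - m))))"
    by (simp add: map_pmf_comp case_prod_beta)
  also have "\<dots> = map_pmf fst (pair_pmf (pmf_of_set (?L m)) (pmf_of_set (?L (n - m))))"
    using fin by (intro map_pmf_cong) auto
  finally show ?thesis by (simp add: map_fst_pair_pmf)
qed

text \<open>The same composed program serves both conclusions. Since \<open>g\<close> turns every
  correct answer into a correct answer, success of the inner run implies success of the outer one,
  and the bound 2/3 carries over without amplification.\<close>

lemma one_query_reduction:
  assumes f: "poly_time_fun f" and g: "poly_time_fun g"
    and h: "\<And>I. I \<in> D \<Longrightarrow> h I \<in> D'" "\<And>I. I \<in> D \<Longrightarrow> enc' (h I) = f (enc I)"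
    and correct: "\<And>I y. I \<in> D \<Longrightarrow> y \<in> correct' (h I) \<Longrightarrow> g (Node (enc I) y) \<in> correct I"
  shows det_poly_time_reduction: "det_poly_time D' enc' correct' \<Longrightarrow> det_poly_time D enc correct"
    and rand_poly_time_reduction: "rand_poly_time D' enc' correct' \<Longrightarrow> rand_poly_time D enc correct"
proof -
  obtain pf where pf: "\<And>x. tsize (f x) \<le> poly pf (tsize x)"
    by (rule poly_time_fun_size[OF f]) (rule that)
  {
    assume "det_poly_time D' enc' correct'"
    then obtain c p where c: "coin_free c" "\<And>J. J \<in> D' \<Longrightarrow>
        \<exists>t y. run c (enc' J) [] t y \<and> t \<le> poly p (tsize (enc' J)) \<and> y \<in> correct' J"
      unfolding det_poly_time_def by blast
    obtain C P where C: "coin_free c \<Longrightarrow> coin_free C"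
      "\<And>x r t y. run c (f x) r t y \<Longrightarrow>
         \<exists>t'. run C x r t' (g (Node x y)) \<and> t' \<le> poly P (tsize x + t)"
      by (rule one_query_program[OF f g, of c]) (rule that)
    have "\<exists>t y. run C (enc I) [] t y \<and>
        t \<le> poly (pcompose P ([:0, 1:] + pcompose p pf)) (tsize (enc I)) \<and> y \<in> correct I"
      if I: "I \<in> D" for I
    proof -
      obtain t y where t: "run c (f (enc I)) [] t y" "t \<le> poly p (tsize (f (enc I)))"
          "y \<in> correct' (h I)"
        using c(2)[OF h(1)[OF I]] h(2)[OF I] by auto
      obtain t' where t': "run C (enc I) [] t' (g (Node (enc I) y))" "t' \<le> poly P (tsize (enc I) + t)"
        using C(2)[OF t(1)] by blast
      have "tsize (enc I) + t \<le> tsize (enc I) + poly p (poly pf (tsize (enc I)))"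
        using t(2) poly_nat_mono[OF pf[of "enc I"], of p] by simp
      from poly_nat_mono[OF this, of P] t' correct[OF I t(3)] show ?thesis
        by (intro exI[of _ t'] exI[of _ "g (Node (enc I) y)"]) (simp add: poly_pcompose)
    qed
    with C(1) c(1) show "det_poly_time D enc correct"
      unfolding det_poly_time_def by blast
  }
  {
    assume "rand_poly_time D' enc' correct'"
    then obtain c p where c: "\<And>J. J \<in> D' \<Longrightarrow>
        (let T = poly p (tsize (enc' J)); R = {r :: bool list. length r = T} in
          (\<forall>r\<in>R. \<exists>t y. run c (enc' J) r t y \<and> t \<le> T) \<and>
          measure_pmf.prob (pmf_of_set R) {r. \<exists>t. \<exists>y\<in>correct' J. run c (enc' J) r t y} \<ge> 2 / 3)"
      unfolding rand_poly_time_def by blast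
    obtain C P where C: "\<And>x r t y. run c (f x) r t y \<Longrightarrow>
         \<exists>t'. run C x r t' (g (Node x y)) \<and> t' \<le> poly P (tsize x + t)"
      by (rule one_query_program[OF f g, of c]) (rule that)
    \<comment> \<open>The first summand bounds the running time; the second ensures at least as many
      coins as the inner algorithm is entitled to.\<close>
    define q where "q = pcompose P ([:0, 1:] + pcompose p pf) + pcompose p pf"
    have "(\<forall>r\<in>{r. length r = poly q (tsize (enc I))}.
          \<exists>t y. run C (enc I) r t y \<and> t \<le> poly q (tsize (enc I))) \<and>
        measure_pmf.prob (pmf_of_set {r. length r = poly q (tsize (enc I))})
          {r. \<exists>t. \<exists>y\<in>correct I. run C (enc I) r t y} \<ge> 2 / 3"
      if I: "I \<in> D" for I
    proof
      let ?x = "enc I"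
      define T where "T = poly p (tsize (f ?x))"
      define T' where "T' = poly q (tsize ?x)"
      define good where "good = {r. \<exists>t. \<exists>y\<in>correct' (h I). run c (f ?x) r t y}"
      note cI = c[OF h(1)[OF I], unfolded h(2)[OF I] Let_def, folded T_def good_def]
      have le: "T \<le> poly p (poly pf (tsize ?x))"
        unfolding T_def by (intro poly_nat_mono pf)
      then have T: "T \<le> T'" by (simp add: T'_def q_def poly_pcompose)
      show "\<forall>r\<in>{r. length r = poly q (tsize ?x)}. \<exists>t y. run C ?x r t y \<and> t \<le> poly q (tsize ?x)"
      proof
        fix r :: "bool list"
        assume r: "r \<in> {r. length r = poly q (tsize ?x)}"
        then have "take T r \<in> {r. length r = T}" using T by (simp add: T'_def)
        then obtain t y where t: "run c (f ?x) (take T r) t y" "t \<le> T" using cI by blast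
        have "run c (f ?x) r t y" using run_append_coins[OF t(1), of "drop T r"] by simp
        from C[OF this] obtain t' where t': "run C ?x r t' (g (Node ?x y))"
            "t' \<le> poly P (tsize ?x + t)"
          by blast
        moreover have "poly P (tsize ?x + t) \<le> poly P (tsize ?x + poly p (poly pf (tsize ?x)))"
          using t(2) le by (intro poly_nat_mono) simp
        ultimately have "t' \<le> poly q (tsize ?x)" by (simp add: q_def poly_pcompose)
        with t' show "\<exists>t y. run C ?x r t y \<and> t \<le> poly q (tsize ?x)" by blast
      qed
      have "2 / 3 \<le> measure_pmf.prob (pmf_of_set {r. length r = T}) good"
        using cI by blast
      also have "\<dots> = measure_pmf.prob (pmf_of_set {r. length r = T'}) (take T -` good)"
        by (simp flip: map_pmf_take_pmf_of_set[OF T])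
      also have "\<dots> \<le> measure_pmf.prob (pmf_of_set {r. length r = T'})
          {r. \<exists>t. \<exists>y\<in>correct I. run C ?x r t y}"
      proof (rule measure_pmf.finite_measure_mono)
        show "take T -` good \<subseteq> {r. \<exists>t. \<exists>y\<in>correct I. run C ?x r t y}"
        proof
          fix r assume "r \<in> take T -` good"
          then obtain t y where y: "y \<in> correct' (h I)" and t: "run c (f ?x) (take T r) t y"
            by (auto simp: good_def)
          have "run c (f ?x) r t y" using run_append_coins[OF t, of "drop T r"] by simp
          from C[OF this] correct[OF I y] show "r \<in> {r. \<exists>t. \<exists>y\<in>correct I. run C ?x r t y}"
            by blast
        qed
      qed simp
      finally show "measure_pmf.prob (pmf_of_set {r. length r = poly q (tsize ?x)})
          {r. \<exists>t. \<exists>y\<in>correct I. run C ?x r t y} \<ge> 2 / 3"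
        by (simp add: T'_def)
    qed
    then show "rand_poly_time D enc correct"
      unfolding rand_poly_time_def Let_def by blast
  }
qed

section \<open>From exact matching to balanced matching\<close>

text \<open>
  Control \<open>j\<close> is the copy of vertex \<open>j div 2\<close> reserved for blue edges if \<open>j\<close> is even and for
  red edges if \<open>j\<close> is odd.
\<close>

definition matches :: "em_instance \<Rightarrow> nat \<Rightarrow> nat \<Rightarrow> bool" where
  "matches I u j \<longleftrightarrow> (u, j div 2) \<in> set (if even j then blue_edges I else red_edges I)"

text \<open>Level 0 of the second covariate is blue, matching even controls. The absolute value
  keeps the construction total: a negative or too large target still gives a valid instance, whose
  answer \<open>accept_tree\<close> rejects.\<close>

definition bm_of_em :: "em_instance \<Rightarrow> bm_instance" where
  "bm_of_em I =
     \<lparr>levels1 = side_size I, levels2 = 2,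
      treatments = map (\<lambda>u. (u, if nat \<bar>target I\<bar> \<le> u then 1 else 0)) [0..<side_size I],
      controls = map (\<lambda>j. (j div 2, j mod 2)) [0..<2 * side_size I],
      distances = map (\<lambda>u. map (\<lambda>j. if matches I u j then 0 else 1) [0..<2 * side_size I])
        [0..<side_size I]\<rparr>"

lemma bm_of_em_sel:
  "levels1 (bm_of_em I) = side_size I" "levels2 (bm_of_em I) = 2"
  "T_set (bm_of_em I) = {0..<side_size I}" "C_set (bm_of_em I) = {0..<2 * side_size I}"
  by (simp_all add: bm_of_em_def T_set_def C_set_def)

lemma delta_bm_of_em:
  "u < side_size I \<Longrightarrow> j < 2 * side_size I \<Longrightarrow>
    delta (bm_of_em I) u j = (if matches I u j then 0 else 1)"
  by (simp add: bm_of_em_def delta_def)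

lemma bm_of_em_in_bm'_instances: "bm_of_em I \<in> bm'_instances 2 [:1:]"
proof -
  have "bm_valid (bm_of_em I)"
    by (auto simp: bm_valid_def bm_of_em_def level_def num_levels_def)
  then show ?thesis
    by (simp add: bm'_instances_def num_levels_def bm_of_em_sel delta_bm_of_em)
qed

text \<open>The condition on red controls follows from the one on blue controls: by injectivity the
  image has \<open>side_size I\<close> elements, so the number of even ones fixes the number of odd
  ones. The bound on the target makes the number of blue treatments exactly its absolute
  value.\<close>

lemma bm_of_em_feasible_iff:
  assumes "nat \<bar>target I\<bar> \<le> side_size I"
  defines "S \<equiv> {0..<side_size I}"
  shows "bm_feasible (bm_of_em I) m \<longleftrightarrow>
    m \<in> S \<rightarrow> {0..<2 * side_size I} \<and> inj_on m S \<and>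
    (\<forall>v<side_size I. card {j \<in> m ` S. j div 2 = v} = 1) \<and>
    card {j \<in> m ` S. even j} = nat \<bar>target I\<bar>"
proof -
  let ?J = "bm_of_em I" and ?q = "side_size I" and ?k = "nat \<bar>target I\<bar>"
  have T: "T_set ?J = S" by (simp add: bm_of_em_sel S_def)
  have all12: "(\<forall>p\<in>{1, 2}. \<forall>i<num_levels ?J p. P p i) \<longleftrightarrow>
      (\<forall>v<?q. P 1 v) \<and> P 2 0 \<and> P 2 (Suc 0)" for P
    by (auto simp: num_levels_def bm_of_em_sel numeral_2_eq_2 less_Suc_eq)
  have control1: "L_control ?J 1 v = {j. j < 2 * ?q \<and> j div 2 = v}" for v
    by (auto simp: L_control_def bm_of_em_sel level_def) (auto simp: bm_of_em_def)
  have control2: "L_control ?J 2 i = {j. j < 2 * ?q \<and> j mod 2 = i}" for i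
    by (auto simp: L_control_def bm_of_em_sel level_def) (auto simp: bm_of_em_def)
  have treat1: "L_treat ?J (Suc 0) v = {v}" if "v < ?q" for v
    using that by (auto simp: L_treat_def bm_of_em_sel level_def) (auto simp: bm_of_em_def)
  have treat2: "L_treat ?J 2 0 = {0..<?k}" "L_treat ?J 2 (Suc 0) = {?k..<?q}"
    using assms by (auto simp: L_treat_def bm_of_em_sel level_def)
      (auto simp: bm_of_em_def split: if_splits)
  have "(\<forall>v<?q. card (m ` S \<inter> L_control ?J 1 v) = card (L_treat ?J 1 v)) \<and>
      card (m ` S \<inter> L_control ?J 2 0) = card (L_treat ?J 2 0) \<and>
      card (m ` S \<inter> L_control ?J 2 (Suc 0)) = card (L_treat ?J 2 (Suc 0)) \<longleftrightarrow>
    (\<forall>v<?q. card {j \<in> m ` S. j div 2 = v} = 1) \<and> card {j \<in> m ` S. even j} = ?k"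
    if m: "m \<in> S \<rightarrow> {0..<2 * ?q}" "inj_on m S"
  proof -
    have "m ` S \<inter> L_control ?J 1 v = {j \<in> m ` S. j div 2 = v}" for v
      unfolding control1 using m by auto
    moreover have even: "m ` S \<inter> L_control ?J 2 0 = {j \<in> m ` S. even j}"
      using m by (auto simp: control2)
    moreover have odd: "m ` S \<inter> L_control ?J 2 (Suc 0) = {j \<in> m ` S. odd j}"
      using m by (auto simp: control2 odd_iff_mod_2_eq_one)
    moreover have "card {j \<in> m ` S. even j} + card {j \<in> m ` S. odd j} = card (m ` S)"
      by (subst card_Un_disjoint[symmetric]) (auto intro!: arg_cong[of _ _ card] simp: S_def)
    then have "card {j \<in> m ` S. even j} + card {j \<in> m ` S. odd j} = ?q"
      using m by (simp add: card_image S_def)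
    ultimately show ?thesis by (auto simp: treat1 treat2)
  qed
  then show ?thesis
    unfolding bm_feasible_def all12 T bm_of_em_sel(4) by blast
qed

text \<open>Shows that the range test on the target never rejects a yes-instance; a perfect matching
  has at most \<open>side_size I\<close> edges because \<open>fst\<close> is injective on
  it.\<close>

lemma has_exact_matching_target:
  assumes "I \<in> em_instances" "has_exact_matching I"
  shows "0 \<le> target I" "nat \<bar>target I\<bar> \<le> side_size I"
proof -
  obtain M where M: "perfect_matching (side_size I) (set (blue_edges I) \<union> set (red_edges I)) M"
    "int (card (M \<inter> set (blue_edges I))) = target I"
    using assms(2) by (auto simp: has_exact_matching_def)
  have "inj_on fst M"
    using M(1) assms(1) unfolding inj_on_def perfect_matching_def em_instances_def by fastforce
  then have "card M = card (fst ` M)" by (simp add: card_image)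
  also have "\<dots> \<le> card {0..<side_size I}"
    using M(1) assms(1) unfolding perfect_matching_def em_instances_def
    by (intro card_mono) fastforce+
  finally have "card M \<le> side_size I" by simp
  moreover have "card (M \<inter> set (blue_edges I)) \<le> card M"
    using M(1) by (intro card_mono) (auto simp: perfect_matching_def intro: finite_subset)
  ultimately show "0 \<le> target I" "nat \<bar>target I\<bar> \<le> side_size I" using M(2) by auto
qed

text \<open>Forgetting the colour of the chosen copy, \<open>u\<close> is matched to
  \<open>m u div 2\<close>. Exactly one copy of each vertex is used, which makes this a perfect
  matching.\<close>

lemma has_exact_matching_if_matches:
  assumes I: "I \<in> em_instances" and k: "0 \<le> target I" "nat \<bar>target I\<bar> \<le> side_size I"
    and m: "bm_feasible (bm_of_em I) m" and good: "\<And>u. u < side_size I \<Longrightarrow> matches I u (m u)"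
  shows "has_exact_matching I"
proof -
  let ?q = "side_size I"
  let ?S = "{0..<?q}"
  let ?M = "(\<lambda>u. (u, m u div 2)) ` ?S"
  from m have inj: "inj_on m ?S"
    and one: "\<And>v. v < ?q \<Longrightarrow> card {j \<in> m ` ?S. j div 2 = v} = 1"
    and even: "card {j \<in> m ` ?S. even j} = nat \<bar>target I\<bar>"
    by (auto simp: bm_of_em_feasible_iff[OF k(2)])
  have "\<exists>!e. e \<in> ?M \<and> snd e = v" if "v < ?q" for v
  proof -
    have "card {j \<in> m ` ?S. j div 2 = v} = 1" by (rule one[OF that])
    then obtain j where j: "{j \<in> m ` ?S. j div 2 = v} = {j}" by (rule card_1_singletonE)
    then have "j \<in> {j \<in> m ` ?S. j div 2 = v}" by blast
    then obtain u where u: "u < ?q" "m u = j" "j div 2 = v" by auto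
    show ?thesis
    proof (rule ex1I[of _ "(u, v)"])
      show "(u, v) \<in> ?M \<and> snd (u, v) = v" using u by auto
    next
      fix e assume "e \<in> ?M \<and> snd e = v"
      then obtain u' where u': "u' < ?q" "m u' div 2 = v" "e = (u', v)" by auto
      then have "m u' \<in> {j \<in> m ` ?S. j div 2 = v}" by auto
      then have "m u' = m u" using j u by simp
      then show "e = (u, v)" using inj u u' by (auto dest: inj_onD)
    qed
  qed
  moreover have "?M \<subseteq> set (blue_edges I) \<union> set (red_edges I)"
    using good by (fastforce simp: matches_def split: if_splits)
  moreover have "\<exists>!e. e \<in> ?M \<and> fst e = u" if "u < ?q" for u
    using that by auto
  ultimately have "perfect_matching ?q (set (blue_edges I) \<union> set (red_edges I)) ?M"
    by (simp add: perfect_matching_def)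
  moreover have "int (card (?M \<inter> set (blue_edges I))) = target I"
  proof -
    \<comment> \<open>Disjointness of the colours enters here: an odd \<open>m u\<close> comes from
      a red edge, which therefore is not blue.\<close>
    have "?M \<inter> set (blue_edges I) = (\<lambda>u. (u, m u div 2)) ` {u \<in> ?S. even (m u)}"
      using good I by (fastforce simp: matches_def em_instances_def split: if_splits)
    then have "card (?M \<inter> set (blue_edges I)) = card {u \<in> ?S. even (m u)}"
      by (simp add: card_image inj_on_def)
    also have "\<dots> = card (m ` {u \<in> ?S. even (m u)})"
      by (intro card_image[symmetric] inj_on_subset[OF inj]) auto
    also have "m ` {u \<in> ?S. even (m u)} = {j \<in> m ` ?S. even j}" by auto
    finally show ?thesis using even k by simp
  qed
  ultimately show ?thesis unfolding has_exact_matching_def by blast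
qed

lemma matches_if_has_exact_matching:
  assumes I: "I \<in> em_instances" and exact: "has_exact_matching I"
  obtains m where "bm_feasible (bm_of_em I) m" "\<And>u. u < side_size I \<Longrightarrow> matches I u (m u)"
proof -
  let ?q = "side_size I" and ?B = "set (blue_edges I)"
  let ?S = "{0..<?q}"
  note k = has_exact_matching_target[OF I exact]
  obtain M where M: "perfect_matching ?q (?B \<union> set (red_edges I)) M"
    "int (card (M \<inter> ?B)) = target I"
    using exact by (auto simp: has_exact_matching_def)
  have M_sub: "M \<subseteq> ?B \<union> set (red_edges I)" "M \<subseteq> ?S \<times> ?S"
    using M(1) I unfolding perfect_matching_def em_instances_def by blast+
  define \<sigma> where "\<sigma> u = snd (THE e. e \<in> M \<and> fst e = u)" for u
  have \<sigma>: "(u, v) \<in> M \<longleftrightarrow> v = \<sigma> u" if "u < ?q" for u v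
  proof -
    have ex1: "\<exists>!e. e \<in> M \<and> fst e = u" using M(1) that by (simp add: perfect_matching_def)
    have "(THE e. e \<in> M \<and> fst e = u) = (u, \<sigma> u)"
      using theI'[OF ex1] by (simp add: \<sigma>_def prod_eq_iff)
    then have "(u, \<sigma> u) \<in> M" using theI'[OF ex1] by simp
    then show ?thesis using ex1 by force
  qed
  have \<sigma>_lt: "\<sigma> u < ?q" if "u < ?q" for u
    using \<sigma>[OF that, of "\<sigma> u"] M_sub by auto
  have \<sigma>_ex1: "\<exists>!u. u < ?q \<and> \<sigma> u = v" if "v < ?q" for v
  proof -
    have "\<exists>!e. e \<in> M \<and> snd e = v" using M(1) that by (simp add: perfect_matching_def)
    then obtain e where e: "e \<in> M" "snd e = v" "\<And>e'. e' \<in> M \<Longrightarrow> snd e' = v \<Longrightarrow> e' = e"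
      by (elim ex1E) blast
    from e(1,2) have e': "(fst e, v) \<in> M" by auto
    with M_sub(2) have "fst e < ?q" by auto
    note e' = e' this
    show ?thesis
    proof (rule ex1I[of _ "fst e"])
      show "fst e < ?q \<and> \<sigma> (fst e) = v" using e' \<sigma> by simp
      show "u = fst e" if "u < ?q \<and> \<sigma> u = v" for u
        using that \<sigma>[of u v] e(3)[of "(u, v)"] by auto
    qed
  qed
  \<comment> \<open>The partner \<sigma> of \<open>u\<close> selects the pair of copies, and the
    colour of the matching edge selects the copy.\<close>
  define m where "m u = 2 * \<sigma> u + (if (u, \<sigma> u) \<in> ?B then 0 else 1)" for u
  have m_div: "m u div 2 = \<sigma> u" and m_even: "even (m u) \<longleftrightarrow> (u, \<sigma> u) \<in> ?B" for u
    by (simp_all add: m_def)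
  have inj: "inj_on m ?S"
  proof (rule inj_onI)
    fix x y assume "x \<in> ?S" "y \<in> ?S" "m x = m y"
    then have *: "x < ?q" "y < ?q" "\<sigma> x = \<sigma> y" using m_div[of x] m_div[of y] by auto
    from \<sigma>_ex1[OF \<sigma>_lt[OF *(1)]] show "x = y"
      by (rule ex1E) (use * in metis)
  qed
  show ?thesis
  proof (rule that[of m])
    show "matches I u (m u)" if "u < ?q" for u
      using \<sigma>[OF that, of "\<sigma> u"] M_sub(1) by (auto simp: matches_def m_div m_even)
    have "m \<in> ?S \<rightarrow> {0..<2 * ?q}"
      using \<sigma>_lt by (fastforce simp: m_def)
    moreover have "card {j \<in> m ` ?S. j div 2 = v} = 1" if v: "v < ?q" for v
    proof -
      obtain u where u: "u < ?q" "\<sigma> u = v" "\<And>u'. u' < ?q \<Longrightarrow> \<sigma> u' = v \<Longrightarrow> u' = u"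
        using \<sigma>_ex1[OF v] by blast
      have "{j \<in> m ` ?S. j div 2 = v} = {m u}"
      proof (intro equalityI subsetI)
        fix j assume "j \<in> {j \<in> m ` ?S. j div 2 = v}"
        then obtain u' where "u' < ?q" "\<sigma> u' = v" "j = m u'" by (auto simp: m_div)
        with u(3) show "j \<in> {m u}" by blast
      qed (use u(1,2) in \<open>auto simp: m_div\<close>)
      then show ?thesis by simp
    qed
    moreover have "card {j \<in> m ` ?S. even j} = nat \<bar>target I\<bar>"
    proof -
      have "{j \<in> m ` ?S. even j} = m ` {u \<in> ?S. (u, \<sigma> u) \<in> ?B}" by (auto simp: m_even)
      then have "card {j \<in> m ` ?S. even j} = card (m ` {u \<in> ?S. (u, \<sigma> u) \<in> ?B})"
        by (rule arg_cong)
      also have "\<dots> = card {u \<in> ?S. (u, \<sigma> u) \<in> ?B}"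
        by (intro card_image inj_on_subset[OF inj]) auto
      also have "\<dots> = card ((\<lambda>u. (u, \<sigma> u)) ` {u \<in> ?S. (u, \<sigma> u) \<in> ?B})"
        by (simp add: card_image inj_on_def)
      also have "(\<lambda>u. (u, \<sigma> u)) ` {u \<in> ?S. (u, \<sigma> u) \<in> ?B} = M \<inter> ?B"
        using \<sigma> M_sub(2) by auto
      finally show ?thesis using M(2) by simp
    qed
    ultimately show "bm_feasible (bm_of_em I) m"
      unfolding bm_of_em_feasible_iff[OF k(2)] using inj by blast
  qed
qed

lemma bm_cost_bm_of_em_eq_0_iff:
  assumes "bm_feasible (bm_of_em I) m"
  shows "bm_cost (bm_of_em I) m = 0 \<longleftrightarrow> (\<forall>u<side_size I. matches I u (m u))"
proof -
  have "m u < 2 * side_size I" if "u < side_size I" for u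
    using assms that by (auto simp: bm_feasible_def bm_of_em_sel)
  then show ?thesis by (auto simp: bm_cost_def bm_of_em_sel delta_bm_of_em)
qed

text \<open>An exact matching yields a feasible map of cost 0, so \<open>None\<close> is impossible
  and every optimal map has cost 0. Conversely, a map along edges of the right colours is already a
  witness, given feasibility. The right-hand side is phrased as the test that
  \<open>accept_tree\<close> can perform.\<close>

lemma has_exact_matching_iff_bm_solution:
  assumes I: "I \<in> em_instances" and z: "bm_solution (bm_of_em I) z"
  shows "has_exact_matching I \<longleftrightarrow> 0 \<le> target I \<and> nat \<bar>target I\<bar> \<le> side_size I \<and>
    (\<exists>ms. z = Some ms \<and> list_all2 (matches I) [0..<side_size I] ms)"
proof
  assume exact: "has_exact_matching I"
  obtain m where m: "bm_feasible (bm_of_em I) m" "\<And>u. u < side_size I \<Longrightarrow> matches I u (m u)"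
    by (rule matches_if_has_exact_matching[OF I exact]) (rule that)
  then obtain ms where ms: "z = Some ms" "length ms = side_size I"
      "bm_optimal (bm_of_em I) (\<lambda>u. ms ! u)"
    using z by (auto simp: bm_solution_def bm_of_em_def split: option.splits)
  then have "bm_cost (bm_of_em I) (\<lambda>u. ms ! u) = 0"
    using m bm_cost_bm_of_em_eq_0_iff[OF m(1)] unfolding bm_optimal_def by fastforce
  then have "\<forall>u<side_size I. matches I u (ms ! u)"
    using ms(3) bm_cost_bm_of_em_eq_0_iff unfolding bm_optimal_def by blast
  then have "list_all2 (matches I) [0..<side_size I] ms"
    using ms(2) by (simp add: list_all2_conv_all_nth)
  with ms(1) has_exact_matching_target[OF I exact]
  show "0 \<le> target I \<and> nat \<bar>target I\<bar> \<le> side_size I \<and>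
      (\<exists>ms. z = Some ms \<and> list_all2 (matches I) [0..<side_size I] ms)"
    by blast
next
  assume "0 \<le> target I \<and> nat \<bar>target I\<bar> \<le> side_size I \<and>
    (\<exists>ms. z = Some ms \<and> list_all2 (matches I) [0..<side_size I] ms)"
  then obtain ms where "0 \<le> target I" "nat \<bar>target I\<bar> \<le> side_size I" "z = Some ms"
      "list_all2 (matches I) [0..<side_size I] ms"
    by blast
  then show "has_exact_matching I"
    using z by (intro has_exact_matching_if_matches[OF I, of "\<lambda>u. ms ! u"])
      (auto simp: bm_solution_def bm_optimal_def list_all2_conv_all_nth)
qed

section \<open>The reduction on encodings\<close>

text \<open>With the least significant bit first, the head of a number is its parity and the tail
  its half, so the colour and the vertex of a control are read off without arithmetic. For 0 this
  relies on \<open>hd_tree Leaf = Leaf\<close>.\<close>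

lemma hd_enc_nat: "hd_tree (enc_nat n) = enc_bool (odd n)"
  by (subst enc_nat.simps) (simp add: enc_bool_def)

lemma tl_enc_nat: "tl_tree (enc_nat n) = enc_nat (n div 2)"
  by (subst enc_nat.simps) (simp add: enc_nat.simps[of 0])

lemma enc_nat_eq_iff: "enc_nat m = enc_nat n \<longleftrightarrow> m = n"
  using enc_nat_inj by blast

lemma enc_nat_0: "enc_nat 0 = Leaf"
  by (simp add: enc_nat.simps)

lemma enc_nat_1: "enc_nat (Suc 0) = Node (Node Leaf Leaf) Leaf"
  by (simp add: enc_nat.simps enc_bool_def)

abbreviation range_of :: "tree \<Rightarrow> tree" where "range_of z \<equiv> hd_tree z"
abbreviation blue_of :: "tree \<Rightarrow> tree" where "blue_of z \<equiv> hd_tree (tl_tree z)"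
abbreviation red_of :: "tree \<Rightarrow> tree" where "red_of z \<equiv> hd_tree (tl_tree (tl_tree z))"
abbreviation sign_of :: "tree \<Rightarrow> tree" where "sign_of z \<equiv> hd_tree (tl_tree (tl_tree (tl_tree z)))"
abbreviation abs_of :: "tree \<Rightarrow> tree" where "abs_of z \<equiv> tl_tree (tl_tree (tl_tree (tl_tree z)))"
abbreviation one_tree :: tree where "one_tree \<equiv> Node (Node Leaf Leaf) Leaf"

text \<open>
  The accumulator consists of the parity of the number of steps and of the list with one element
  dropped every second step.
\<close>

definition halve_step :: "tree \<Rightarrow> tree \<Rightarrow> tree" where
  "halve_step x a = (if hd_tree a = Leaf then Node (Node Leaf Leaf) (tl_tree a)
     else Node Leaf (tl_tree (tl_tree a)))"

definition halve :: "tree \<Rightarrow> tree" where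
  "halve y = fold halve_step (items y) (Node Leaf y)"

lemma poly_time_fun_halve:
  assumes l: "poly_time_fun l"
  shows "poly_time_fun (\<lambda>z. halve (l z))"
proof -
  have "tsize (halve_step x a) \<le> tsize a + poly [:4:] n" for x a n
    using tsize_tl_tree[of a] tsize_tl_tree[of "tl_tree a"] by (simp add: halve_step_def)
  then have "\<exists>g. \<forall>z a. \<forall>x\<in>set (items (l z)). tsize (halve_step x a) \<le> tsize a + poly g (tsize z)"
    by blast
  then show ?thesis
    unfolding halve_def
    by (intro poly_time_fun_fold[where F = "\<lambda>z. halve_step", OF _ l])
      (unfold halve_step_def, (intro poly_time_fun_if poly_time_pred_eq poly_time_fun_Node
        poly_time_fun_hd poly_time_fun_tl poly_time_fun_id poly_time_fun_Leaf l)+)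
qed

text \<open>Serves to test whether the target equals q. The number q is missing from the list of 0
  to q - 1, but q > 0 implies that q div 2 is in it, at the front once q div 2 entries are dropped.
  For q = 0 the head of the empty list is \<open>Leaf\<close>, which encodes 0.\<close>

lemma halve_enc_range:
  "hd_tree (halve (enc_range q)) = enc_bool (odd q)"
  "hd_tree (tl_tree (halve (enc_range q))) = enc_nat (q div 2)"
proof -
  have fold: "fold halve_step xs (Node Leaf y)
      = Node (enc_bool (odd (length xs))) ((tl_tree ^^ (length xs div 2)) y)" for xs y
  proof (induction xs rule: rev_induct)
    case (snoc x xs)
    then show ?case by (auto simp: halve_step_def enc_bool_def)
  qed (simp add: enc_bool_def)
  have drop: "(tl_tree ^^ n) (enc_list f xs) = enc_list f (drop n xs)"
    for n and f :: "nat \<Rightarrow> tree" and xs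
  proof (induction n)
    case (Suc n)
    then show ?case by (cases "drop n xs") (auto simp: drop_Suc simp flip: tl_drop)
  qed simp
  have halve: "halve (enc_range q)
      = Node (enc_bool (odd q)) (enc_list enc_nat (drop (q div 2) [0..<q]))"
    by (simp add: halve_def fold enc_range_def items_enc_list drop)
  then show "hd_tree (halve (enc_range q)) = enc_bool (odd q)" by simp
  show "hd_tree (tl_tree (halve (enc_range q))) = enc_nat (q div 2)"
  proof (cases "q = 0")
    case True
    then show ?thesis by (simp add: halve_def enc_range_def enc_nat_0)
  next
    case False
    have "drop (q div 2) [0..<q] = [q div 2..<q]" by (simp only: drop_upt add_0)
    also have "\<dots> = q div 2 # [Suc (q div 2)..<q]" by (rule upt_conv_Cons) (use False in simp)
    finally have "drop (q div 2) [0..<q] = q div 2 # [Suc (q div 2)..<q]" .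
    then show ?thesis by (simp only: halve hd_tree.simps tl_tree.simps enc_list.simps)
  qed
qed

text \<open>The accumulator consists of the current level, which becomes 1 at \<open>k\<close>, and the reversed output.\<close>

definition treatment_step :: "tree \<Rightarrow> tree \<Rightarrow> tree \<Rightarrow> tree" where
  "treatment_step k x a = (if x = k \<or> hd_tree a \<noteq> Leaf
     then Node one_tree (Node (Node x one_tree) (tl_tree a))
     else Node Leaf (Node (Node x Leaf) (tl_tree a)))"

definition treatment_tree :: "tree \<Rightarrow> tree" where
  "treatment_tree z = tree_of_list (rev (items (tl_tree
     (fold (treatment_step (abs_of z)) (items (range_of z)) Leaf))))"

lemma poly_time_fun_treatment_tree: "poly_time_fun treatment_tree"
proof -
  note ptf = poly_time_fun_hd poly_time_fun_tl poly_time_fun_id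
  \<comment> \<open>The 13 consists of two copies of \<open>one_tree\<close>, of size 5 each, and
    three new inner nodes.\<close>
  have "tsize (treatment_step k x a) \<le> tsize a + poly [:13, 1:] (tsize z)"
    if "x \<in> set (items (range_of z))" for k x a z
    using tsize_tl_tree[of a] tsize_items_le[OF that] tsize_hd_tree[of z]
    by (simp add: treatment_step_def)
  then have growth: "\<exists>g. \<forall>z a. \<forall>x\<in>set (items (range_of z)).
      tsize (treatment_step (abs_of z) x a) \<le> tsize a + poly g (tsize z)"
    by blast
  have "poly_time_fun (\<lambda>z. fold (treatment_step (abs_of z)) (items (range_of z)) Leaf)"
    by (rule poly_time_fun_fold[where F = "\<lambda>z. treatment_step (abs_of z)", OF _ _ _ growth])
      (unfold treatment_step_def, (intro poly_time_fun_if poly_time_pred_disj poly_time_pred_not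
        poly_time_pred_eq poly_time_fun_Node ptf poly_time_fun_Leaf)+)
  then show ?thesis
    unfolding treatment_tree_def by (intro poly_time_fun_rev poly_time_fun_tl)
qed

lemma treatment_tree_enc_em:
  "treatment_tree (enc_em I)
    = enc_list (enc_prod enc_nat enc_nat) (treatments (bm_of_em I))"
proof -
  let ?k = "nat \<bar>target I\<bar>"
  let ?f = "\<lambda>u. enc_prod enc_nat enc_nat (u, if ?k \<le> u then 1 else 0)"
  \<comment> \<open>The claim starts at \<open>Suc n\<close> because the initial accumulator is
    \<open>Leaf\<close>, not a node; its head and tail act as level 0 and the empty output.\<close>
  have "fold (treatment_step (enc_nat ?k)) (map enc_nat [0..<Suc n]) Leaf
      = Node (if ?k < Suc n then one_tree else Leaf) (tree_of_list (rev (map ?f [0..<Suc n])))" for n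
    by (induction n)
      (auto simp: treatment_step_def enc_prod_def enc_nat_eq_iff enc_nat_0 enc_nat_1
        enc_nat_eq_iff[of 0, unfolded enc_nat_0])
  then have "tl_tree (fold (treatment_step (enc_nat ?k)) (map enc_nat [0..<n]) Leaf)
      = tree_of_list (rev (map ?f [0..<n]))" for n
    by (cases n) auto
  then show ?thesis
    by (simp add: treatment_tree_def enc_em_def enc_int_def enc_range_def items_enc_list
        bm_of_em_def enc_list_map[of "enc_prod enc_nat enc_nat"] comp_def)
qed

text \<open>\<open>Leaf\<close> and \<open>one_tree\<close> are the numbers 0 and 1, and
  \<open>Node Leaf (Node one_tree Leaf)\<close> lists the two colours. Blue and red entries
  alternate, in accordance with even and odd controls.\<close>

definition reduction_tree :: "tree \<Rightarrow> tree" where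
  "reduction_tree z = Node (range_of z) (Node (Node Leaf (Node one_tree Leaf))
     (Node (treatment_tree z)
       (Node (tree_of_list (concat (map (\<lambda>v. [Node v Leaf, Node v one_tree]) (items (range_of z)))))
         (tree_of_list (map (\<lambda>u. tree_of_list (concat (map (\<lambda>v.
             [if Node u v \<in> set (items (blue_of z)) then Leaf else one_tree,
              if Node u v \<in> set (items (red_of z)) then Leaf else one_tree])
             (items (range_of z))))) (items (range_of z)))))))"

lemma poly_time_fun_reduction_tree: "poly_time_fun reduction_tree"
  unfolding reduction_tree_def
  by (intro poly_time_fun_Node poly_time_fun_treatment_tree poly_time_fun_map_pairs
      poly_time_fun_map poly_time_fun_if poly_time_pred_mem
      poly_time_fun_hd poly_time_fun_tl poly_time_fun_id poly_time_fun_Leaf)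

lemma map_upt_double: "map f [0..<2 * n] = concat (map (\<lambda>v. [f (2 * v), f (Suc (2 * v))]) [0..<n])"
  by (induction n) auto

lemma Node_enc_nat_mem_iff:
  "Node (enc_nat u) (enc_nat v) \<in> set (items (enc_list (enc_prod enc_nat enc_nat) E))
    \<longleftrightarrow> (u, v) \<in> set E"
  by (force simp: items_enc_list enc_prod_def enc_nat_eq_iff image_iff)

lemma reduction_tree_enc_em: "reduction_tree (enc_em I) = enc_bm (bm_of_em I)"
proof -
  let ?q = "side_size I"
  have two: "enc_range 2 = Node Leaf (Node one_tree Leaf)"
    by (simp add: enc_range_def numeral_2_eq_2 enc_nat_0 enc_nat_1)
  have ctrls: "tree_of_list (concat (map (\<lambda>v. [Node v Leaf, Node v one_tree]) (items (enc_range ?q))))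
      = enc_list (enc_prod enc_nat enc_nat) (controls (bm_of_em I))"
    by (simp add: bm_of_em_def enc_range_def items_enc_list map_upt_double map_concat comp_def
        enc_list_map[of "enc_prod enc_nat enc_nat"] enc_prod_def enc_nat_0 enc_nat_1)
  have bit: "enc_nat (if b then 0 else 1) = (if b then Leaf else one_tree)" for b
    by (simp add: enc_nat_0 enc_nat_1)
  have row: "tree_of_list (concat (map (\<lambda>v.
      [if Node (enc_nat u) v \<in> set (items (enc_list (enc_prod enc_nat enc_nat) (blue_edges I)))
         then Leaf else one_tree,
       if Node (enc_nat u) v \<in> set (items (enc_list (enc_prod enc_nat enc_nat) (red_edges I)))
         then Leaf else one_tree]) (items (enc_range ?q))))
      = enc_list enc_nat (map (\<lambda>j. if matches I u j then 0 else 1) [0..<2 * ?q])" for u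
    unfolding enc_list_map[of enc_nat] map_map comp_def bit map_upt_double
    by (simp add: enc_range_def items_enc_list[of enc_nat] map_concat comp_def bit
        Node_enc_nat_mem_iff matches_def)
  have "tree_of_list (map (\<lambda>u. tree_of_list (concat (map (\<lambda>v.
      [if Node u v \<in> set (items (enc_list (enc_prod enc_nat enc_nat) (blue_edges I)))
         then Leaf else one_tree,
       if Node u v \<in> set (items (enc_list (enc_prod enc_nat enc_nat) (red_edges I)))
         then Leaf else one_tree]) (items (enc_range ?q))))) (items (enc_range ?q)))
      = enc_list (enc_list enc_nat) (distances (bm_of_em I))"
    unfolding enc_list_map[of "enc_list enc_nat"] enc_range_def[of ?q] items_enc_list[of enc_nat]
      map_map comp_def
    using row[unfolded enc_range_def items_enc_list[of enc_nat] map_map comp_def]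
    by (simp add: bm_of_em_def comp_def del: items_enc_list)
  then show ?thesis
    using two ctrls treatment_tree_enc_em[of I]
    by (simp add: reduction_tree_def enc_em_def enc_bm_def bm_of_em_sel)
qed

text \<open>The argument pairs the original input with the answer. The target is at most q if it is
  listed among 0 to q - 1 or agrees with q in parity and half. The edges are checked against the
  original colour lists, so the distances are not recomputed.\<close>

definition accept_tree :: "tree \<Rightarrow> tree" where
  "accept_tree w = enc_bool (tl_tree w \<noteq> Leaf \<and> sign_of (hd_tree w) = Leaf \<and>
     (abs_of (hd_tree w) \<in> set (items (range_of (hd_tree w))) \<or>
        hd_tree (abs_of (hd_tree w)) = hd_tree (halve (range_of (hd_tree w))) \<and>
        tl_tree (abs_of (hd_tree w)) = hd_tree (tl_tree (halve (range_of (hd_tree w))))) \<and>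
     list_all2 (\<lambda>u m. Node u (tl_tree m) \<in> set (items
         (if hd_tree m = Leaf then blue_of (hd_tree w) else red_of (hd_tree w))))
       (items (range_of (hd_tree w))) (items (tl_tree (tl_tree w))))"

lemma poly_time_fun_accept_tree: "poly_time_fun accept_tree"
  unfolding accept_tree_def
  by (intro poly_time_fun_enc_bool poly_time_pred_conj poly_time_pred_disj poly_time_pred_not
      poly_time_pred_eq poly_time_pred_mem poly_time_pred_list_all2 poly_time_fun_if
      poly_time_fun_Node poly_time_fun_halve
      poly_time_fun_hd poly_time_fun_tl poly_time_fun_id poly_time_fun_Leaf)

lemma accept_tree_enc:
  "accept_tree (Node (enc_em I) (enc_option (enc_list enc_nat) z)) =
    enc_bool (0 \<le> target I \<and> nat \<bar>target I\<bar> \<le> side_size I \<and>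
      (\<exists>ms. z = Some ms \<and> list_all2 (matches I) [0..<side_size I] ms))"
proof -
  let ?k = "nat \<bar>target I\<bar>" and ?q = "side_size I"
  have parity: "odd a = odd b \<and> a div 2 = b div 2 \<longleftrightarrow> a = b" for a b :: nat
    by presburger
  have "enc_nat ?k \<in> set (items (enc_range ?q)) \<longleftrightarrow> ?k < ?q"
    by (auto simp: enc_range_def items_enc_list enc_nat_eq_iff)
  moreover have "enc_bool (odd ?k) = enc_bool (odd ?q) \<and> enc_nat (?k div 2) = enc_nat (?q div 2)
      \<longleftrightarrow> ?k = ?q"
    using parity[of ?k ?q] by (simp add: enc_bool_inj enc_nat_eq_iff)
  ultimately have le: "enc_nat ?k \<in> set (items (enc_range ?q)) \<or>
      enc_bool (odd ?k) = enc_bool (odd ?q) \<and> enc_nat (?k div 2) = enc_nat (?q div 2)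
      \<longleftrightarrow> ?k \<le> ?q"
    by auto
  have matches: "Node (enc_nat u) (tl_tree (enc_nat j)) \<in> set (items
      (if hd_tree (enc_nat j) = Leaf then enc_list (enc_prod enc_nat enc_nat) (blue_edges I)
       else enc_list (enc_prod enc_nat enc_nat) (red_edges I))) \<longleftrightarrow> matches I u j" for u j
    by (simp add: hd_enc_nat tl_enc_nat enc_bool_eq_Leaf Node_enc_nat_mem_iff matches_def)
  have list: "list_all2 (\<lambda>u m. Node u (tl_tree m) \<in> set (items
      (if hd_tree m = Leaf then enc_list (enc_prod enc_nat enc_nat) (blue_edges I)
       else enc_list (enc_prod enc_nat enc_nat) (red_edges I))))
      (items (enc_range ?q)) (items (enc_list enc_nat ms))
      \<longleftrightarrow> list_all2 (matches I) [0..<?q] ms" for ms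
    by (simp only: enc_range_def items_enc_list list.rel_map matches)
  show ?thesis
  proof (cases z)
    case None
    then show ?thesis by (simp add: accept_tree_def enc_option_def)
  next
    case (Some ms)
    show ?thesis
      unfolding Some accept_tree_def enc_option_def enc_em_def enc_int_def option.case
        hd_tree.simps tl_tree.simps enc_bool_eq_Leaf hd_enc_nat tl_enc_nat halve_enc_range le list
      by (simp add: not_less)
  qed
qed

theorem theorem4p4:
  shows
    "((\<forall>(k2 :: nat) (\<pi> :: nat poly). det_poly_time (bm'_instances k2 \<pi>) enc_bm bm_correct)
        \<longrightarrow> det_poly_time em_instances enc_em em_correct) \<and>
     ((\<forall>(k2 :: nat) (\<pi> :: nat poly). rand_poly_time (bm'_instances k2 \<pi>) enc_bm bm_correct)
        \<longrightarrow> rand_poly_time em_instances enc_em em_correct)"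
proof (intro conjI impI)
  have correct: "accept_tree (Node (enc_em I) y) \<in> em_correct I"
    if I: "I \<in> em_instances" and y: "y \<in> bm_correct (bm_of_em I)" for I y
  proof -
    obtain z where "y = enc_option (enc_list enc_nat) z" "bm_solution (bm_of_em I) z"
      using y by (auto simp: bm_correct_def)
    then show ?thesis
      by (simp add: accept_tree_enc em_correct_def has_exact_matching_iff_bm_solution[OF I])
  qed
  note reduction = poly_time_fun_reduction_tree poly_time_fun_accept_tree
    \<comment> \<open>The hypothesis on BM' is instantiated with 2 levels, one per colour, and the
      constant polynomial 1, as all distances are 0 or 1.\<close>
    bm_of_em_in_bm'_instances reduction_tree_enc_em[symmetric] correct
  show "det_poly_time em_instances enc_em em_correct"
    if "\<forall>(k2 :: nat) (\<pi> :: nat poly). det_poly_time (bm'_instances k2 \<pi>) enc_bm bm_correct"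
    by (rule det_poly_time_reduction[where h = bm_of_em and D = em_instances
        and D' = "bm'_instances 2 [:1:]" and enc = enc_em and enc' = enc_bm
        and correct = em_correct and correct' = bm_correct, OF reduction]) (use that in auto)
  show "rand_poly_time em_instances enc_em em_correct"
    if "\<forall>(k2 :: nat) (\<pi> :: nat poly). rand_poly_time (bm'_instances k2 \<pi>) enc_bm bm_correct"
    by (rule rand_poly_time_reduction[where h = bm_of_em and D = em_instances
        and D' = "bm'_instances 2 [:1:]" and enc = enc_em and enc' = enc_bm
        and correct = em_correct and correct' = bm_correct, OF reduction]) (use that in auto)
qed

end
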